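(* Let $p(x,y)=\sum_{i=0}^{n}\sum_{j=0}^{n-i}p_{ij}x^iy^j$ be a non-constant square-free bivariate polynomial of degree $n$ with complex coefficients, with homogenization $p_h(x,y,z)=\sum_{i=0}^{n}\sum_{j=0}^{n-i}p_{ij}x^iy^jz^{n-i-j}$. Consider the properties (a) $p_{n0}\ne 0$; (b) all zeros $\xi_1,\ldots,\xi_n$ of the polynomial $h(\xi):=p_h(\xi,1,0)=p_{n0}\xi^n+p_{n-1,1}\xi^{n-1}+\cdots+p_{0n}$ are simple (equivalently, in the projective plane the line $z=0$ and the curve $p_h(x,y,z)=0$ intersect in $n$ distinct points). (1) Properties (a) and (b) hold for a generic square-free $p$; if they do not hold for $p$, then they hold for the polynomial obtained from $p$ by a random (generic) linear substitution $(x,y,z)^{\mathsf T}=T(\widetilde x,\widetilde y,\widetilde z)^{\mathsf T}$ in $p_h$, where $T$ is a nonsingular $3\times 3$ matrix. (2) Suppose $p$ satisfies (a) and (b). Let $s$ be one of the roots of $h$ and let $$t=-\frac{p_{n-1,0}s^{n-1}+p_{n-2,1}s^{n-2}+\cdots+p_{1,n-2}s+p_{0,n-1}}{h'(s)},$$ which is well defined because $h'(s)\ne 0$. Apply the linear substitution $$x=\widetilde x+s\widetilde y+t\widetilde z,\qquad y=\widetilde y,\qquad z=\widetilde z,$$ and let $\widetilde p_{ij}$ be the coefficients of the transformed polynomial. Then $\widetilde p_{0n}=\widetilde p_{0,n-1}=0$, while properties (a) and (b) still hold: $\widetilde p_{n0}=p_{n0}\ne 0$, and, since $\widetilde p_h(\xi,1,0)=p_h(\xi+s,1,0)$,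 the zeros are only shifted by $s$ and remain simple. (3) Consequently, after these preliminary linear transformations the (transformed) polynomial, again written with coefficients $p_{ij}$, satisfies: (a) $p_{n0}\ne 0$; (b) all zeros $\xi_1,\ldots,\xi_{n-1}$ of $v(\xi):=p_{n0}\xi^{n-1}+p_{n-1,1}\xi^{n-2}+\cdots+p_{1,n-1}$ are simple and nonzero; (c) $p_{0n}=p_{0,n-1}=0$.
   Context: A polynomial is square-free if it is not a multiple of the square of a non-constant polynomial. The degree is the total degree, i.e. $p_{ij}\ne 0$ for at least one pair with $i+j=n$. For a nonsingular $3\times 3$ matrix $T$, the substitution $(x,y,z)^{\mathsf T}=T(\widetilde x,\widetilde y,\widetilde z)^{\mathsf T}$ turns $p_h(x,y,z)$ into a homogeneous polynomial $\widetilde p_h(\widetilde x,\widetilde y,\widetilde z)=\sum_{i=0}^{n}\sum_{j=0}^{n-i}\widetilde p_{ij}\,\widetilde x^{\,i}\,\widetilde y^{\,j}\,\widetilde z^{\,n-i-j}$; the transformed polynomial is the bivariate polynomial with coefficients $\widetilde p_{ij}$. *)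

theory Defs
  imports "HOL-Analysis.Analysis" "HOL-Computational_Algebra.Computational_Algebra"
begin

(* A bivariate polynomial is an element of C[x][y] = complex poly poly, a trivariate one an
   element of C[x][y][z]; the outermost variable is y resp. z. *)

definition coeff2 :: "complex poly poly \<Rightarrow> nat \<Rightarrow> nat \<Rightarrow> complex" where
  "coeff2 p i j = coeff (coeff p j) i"

definition coeff3 :: "complex poly poly poly \<Rightarrow> nat \<Rightarrow> nat \<Rightarrow> nat \<Rightarrow> complex" where
  "coeff3 P i j k = coeff (coeff (coeff P k) j) i"

definition has_total_degree :: "complex poly poly \<Rightarrow> nat \<Rightarrow> bool" where
  "has_total_degree p n \<longleftrightarrow>
     (\<forall>i j. coeff2 p i j \<noteq> 0 \<longrightarrow> i + j \<le> n) \<and> (\<exists>i j. i + j = n \<and> coeff2 p i j \<noteq> 0)"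

(* The library's squarefree asks that every y with y^2 dvd p is a unit; in C[x,y] this is the
   usual condition: *)

lemma squarefree_iff_no_square_factor:
  fixes p :: "complex poly poly"
  shows "squarefree p \<longleftrightarrow> \<not> (\<exists>q. (\<exists>i j. 0 < i + j \<and> coeff2 q i j \<noteq> 0) \<and> q\<^sup>2 dvd p)"
proof -
  have unit_imp: "q dvd 1 \<Longrightarrow> \<not> (\<exists>i j. 0 < i + j \<and> coeff2 q i j \<noteq> 0)" for q :: "complex poly poly"
  proof -
    assume "q dvd 1"
    then obtain c where q: "q = [:c:]" and "c dvd 1"
      using is_unit_poly_iff[of q] by auto
    then obtain d where "c = [:d:]"
      using is_unit_poly_iff[of c] by auto
    then show ?thesis
      using q by (auto simp: coeff2_def coeff_pCons split: nat.splits)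
  qed
  have const_imp: "q = 0 \<or> q dvd 1" if const: "\<not> (\<exists>i j. 0 < i + j \<and> coeff2 q i j \<noteq> 0)"
    for q :: "complex poly poly"
  proof -
    have "coeff q j = coeff [:[:coeff2 q 0 0:]:] j" for j
    proof (rule poly_eqI)
      fix i
      show "coeff (coeff q j) i = coeff (coeff [:[:coeff2 q 0 0:]:] j) i"
        using const[simplified, rule_format, of i j]
        by (auto simp: coeff2_def coeff_pCons split: nat.splits)
    qed
    then have "q = [:[:coeff2 q 0 0:]:]" by (rule poly_eqI)
    moreover have "[:[:c:]:] = 0 \<or> [:[:c:]:] dvd (1 :: complex poly poly)" for c
      by (cases "c = 0") (simp_all add: is_unit_const_poly_iff dvd_field_iff)
    ultimately show ?thesis by metis
  qed
  show ?thesis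
  proof (cases "p = 0")
    case True
    have "\<exists>i j. 0 < i + j \<and> coeff2 [:0, 1:] i j \<noteq> 0"
      by (rule exI[of _ 0], rule exI[of _ 1]) (simp add: coeff2_def)
    moreover have "\<not> squarefree (0 :: complex poly poly)" by simp
    ultimately show ?thesis using True by (metis dvd_0_right)
  next
    case False
    then show ?thesis
      unfolding squarefree_def using unit_imp const_imp
      by (metis dvd_0_left zero_power2)
  qed
qed

definition homogenization :: "nat \<Rightarrow> complex poly poly \<Rightarrow> complex poly poly poly" where
  "homogenization n p =
     (\<Sum>i\<le>n. \<Sum>j\<le>n - i. monom (monom (monom (coeff2 p i j) i) j) (n - i - j))"

(* Evaluation of a trivariate polynomial at a point (x, y, z) of a C-algebra, the structure map
   being emb. *)
definition eval3 :: "(complex \<Rightarrow> 'a::comm_ring_1) \<Rightarrow> complex poly poly poly \<Rightarrow> 'a \<Rightarrow> 'a \<Rightarrow> 'a \<Rightarrow> 'a" where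
  "eval3 emb P x y z =
     poly (map_poly (\<lambda>q. poly (map_poly (\<lambda>r. poly (map_poly emb r) x) q) y) P) z"

definition linear_form :: "complex ^ 3 \<Rightarrow> complex poly poly poly" where
  "linear_form a = [:[:[:0, a $ 1:]:]:] + [:[:0, [:a $ 2:]:]:] + [:0, [:[:a $ 3:]:]:]"

definition linear_subst :: "complex ^ 3 ^ 3 \<Rightarrow> complex poly poly poly \<Rightarrow> complex poly poly poly" where
  "linear_subst T P =
     eval3 (\<lambda>c. [:[:[:c:]:]:]) P (linear_form (T $ 1)) (linear_form (T $ 2)) (linear_form (T $ 3))"

(* The transformed polynomial is always read off with respect to the original n, even if its
   total degree should turn out to be smaller. *)
definition transformed :: "nat \<Rightarrow> complex ^ 3 ^ 3 \<Rightarrow> complex poly poly \<Rightarrow> complex poly poly" where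
  "transformed n T p =
     (\<Sum>i\<le>n. \<Sum>j\<le>n - i.
        monom (monom (coeff3 (linear_subst T (homogenization n p)) i j (n - i - j)) i) j)"

definition h_poly :: "nat \<Rightarrow> complex poly poly \<Rightarrow> complex poly" where
  "h_poly n p = eval3 (\<lambda>c. [:c:]) (homogenization n p) [:0, 1:] 1 0"

definition prop_a :: "nat \<Rightarrow> complex poly poly \<Rightarrow> bool" where
  "prop_a n p \<longleftrightarrow> coeff2 p n 0 \<noteq> 0"

(* rsquarefree h: h is not the zero polynomial and each of its zeros has order 1. *)
definition prop_b :: "nat \<Rightarrow> complex poly poly \<Rightarrow> bool" where
  "prop_b n p \<longleftrightarrow> rsquarefree (h_poly n p)"

definition proj_point :: "complex ^ 3 \<Rightarrow> (complex ^ 3) set" where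
  "proj_point w = {c *s w | c. c \<noteq> 0}"

definition points_at_infinity :: "nat \<Rightarrow> complex poly poly \<Rightarrow> (complex ^ 3) set set" where
  "points_at_infinity n p =
     {proj_point w | w. w \<noteq> 0 \<and> w $ 3 = 0 \<and>
        eval3 (\<lambda>c. c) (homogenization n p) (w $ 1) (w $ 2) (w $ 3) = 0}"

(* Polynomial functions in a given set C of coordinate functions. *)
inductive_set polynomial_functions :: "('a \<Rightarrow> complex) set \<Rightarrow> ('a \<Rightarrow> complex) set"
  for C :: "('a \<Rightarrow> complex) set" where
  const: "(\<lambda>_. c) \<in> polynomial_functions C"
| coord: "f \<in> C \<Longrightarrow> f \<in> polynomial_functions C"
| add: "f \<in> polynomial_functions C \<Longrightarrow> g \<in> polynomial_functions C \<Longrightarrow>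
    (\<lambda>u. f u + g u) \<in> polynomial_functions C"
| mult: "f \<in> polynomial_functions C \<Longrightarrow> g \<in> polynomial_functions C \<Longrightarrow>
    (\<lambda>u. f u * g u) \<in> polynomial_functions C"

(* Q holds for generic elements of X: it holds on a principal Zariski-open subset
   {u \<in> X. \<Phi> u \<noteq> 0} that is Zariski-dense in X. *)
definition generic :: "('a \<Rightarrow> complex) set \<Rightarrow> 'a set \<Rightarrow> ('a \<Rightarrow> bool) \<Rightarrow> bool" where
  "generic C X Q \<longleftrightarrow>
     (\<exists>\<Phi> \<in> polynomial_functions C.
        (\<forall>u\<in>X. \<Phi> u \<noteq> 0 \<longrightarrow> Q u) \<and>
        (\<forall>\<Psi> \<in> polynomial_functions C.
           (\<forall>u\<in>X. \<Phi> u \<noteq> 0 \<longrightarrow> \<Psi> u = 0) \<longrightarrow> (\<forall>u\<in>X. \<Psi> u = 0)))"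

definition coefficient_functions :: "nat \<Rightarrow> (complex poly poly \<Rightarrow> complex) set" where
  "coefficient_functions n = {(\<lambda>p. coeff2 p i j) | i j. i + j \<le> n}"

definition entry_functions :: "(complex ^ 3 ^ 3 \<Rightarrow> complex) set" where
  "entry_functions = {(\<lambda>T. T $ i $ j) | i j. True}"

definition t_value :: "nat \<Rightarrow> complex poly poly \<Rightarrow> complex \<Rightarrow> complex" where
  "t_value n p s = - (\<Sum>i<n. coeff2 p i (n - 1 - i) * s ^ i) / poly (pderiv (h_poly n p)) s"

definition shear :: "complex \<Rightarrow> complex \<Rightarrow> complex ^ 3 ^ 3" where
  "shear s t = vector [vector [1, s, t], vector [0, 1, 0], vector [0, 0, 1]]"

definition v_poly :: "nat \<Rightarrow> complex poly poly \<Rightarrow> complex poly" where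
  "v_poly n p = (\<Sum>i<n. monom (coeff2 p (i + 1) (n - 1 - i)) i)"

(* The outcome r of the first preliminary step: p itself if it has (a) and (b), otherwise the
   result of a linear substitution that achieves (a) and (b). *)
definition first_step :: "nat \<Rightarrow> complex poly poly \<Rightarrow> complex poly poly \<Rightarrow> bool" where
  "first_step n p r \<longleftrightarrow>
     prop_a n r \<and> prop_b n r \<and>
     (if prop_a n p \<and> prop_b n p then r = p
      else \<exists>T. invertible T \<and> r = transformed n T p)"

lemma map_poly_monom': "f 0 = 0 \<Longrightarrow> map_poly f (monom c k) = monom (f c) k"
  by (rule poly_eqI) (simp add: coeff_map_poly)

lemma eval3_homogenization:
  fixes emb :: "complex \<Rightarrow> 'a::comm_ring_1"
  assumes emb: "emb 0 = 0" "\<And>a b. emb (a + b) = emb a + emb b"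
  shows "eval3 emb (homogenization n p) x y z =
    (\<Sum>i\<le>n. \<Sum>j\<le>n - i. emb (coeff2 p i j) * x ^ i * y ^ j * z ^ (n - i - j))"
proof -
  define E1 where "E1 = (\<lambda>r. poly (map_poly emb r) x)"
  define E2 where "E2 = (\<lambda>q. poly (map_poly E1 q) y)"
  define E3 where "E3 = (\<lambda>P. poly (map_poly E2 P) z)"
  have map_add: "map_poly f (a + b) = map_poly f a + map_poly f b"
    if "f 0 = 0" "\<And>a b. f (a + b) = f a + f b"
    for f :: "'c::comm_ring_1 \<Rightarrow> 'd::comm_ring_1" and a b
    by (rule poly_eqI) (simp add: coeff_map_poly that)
  have E1: "E1 0 = 0" "E1 (a + b) = E1 a + E1 b" for a b
    by (simp_all add: E1_def map_add emb)
  have E2: "E2 0 = 0" "E2 (a + b) = E2 a + E2 b" for a b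
    by (simp_all add: E2_def map_add E1)
  have E3: "E3 0 = 0" "E3 (a + b) = E3 a + E3 b" for a b
    by (simp_all add: E3_def map_add E2)
  have E3_sum: "E3 (sum f A) = (\<Sum>i\<in>A. E3 (f i))" for f :: "nat \<Rightarrow> _" and A
    by (induction A rule: infinite_finite_induct) (simp_all add: E3)
  have monom: "E3 (monom (monom (monom c i) j) k) = emb c * x ^ i * y ^ j * z ^ k" for c i j k
    by (simp add: E3_def E2_def E1_def map_poly_monom' E1[unfolded E1_def]
        E2[unfolded E2_def E1_def] emb poly_monom)
  have "eval3 emb (homogenization n p) x y z = E3 (homogenization n p)"
    by (simp add: eval3_def E1_def E2_def E3_def)
  then show ?thesis by (simp add: homogenization_def E3_sum monom)
qed

lemma h_poly_eq: "h_poly n p = (\<Sum>i\<le>n. monom (coeff2 p i (n - i)) i)"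
proof -
  have "(\<Sum>j\<le>n - i. [:coeff2 p i j:] * [:0, 1:] ^ i * 1 ^ j * 0 ^ (n - i - j))
      = monom (coeff2 p i (n - i)) i" if "i \<le> n" for i
  proof -
    have "(\<Sum>j\<le>n - i. [:coeff2 p i j:] * [:0, 1:] ^ i * 1 ^ j * 0 ^ (n - i - j))
      = (\<Sum>j\<in>{n - i}. [:coeff2 p i j:] * [:0, 1:] ^ i)"
      by (rule sum.mono_neutral_cong_right) (auto simp: power_0_left)
    then show ?thesis by (simp add: monom_altdef)
  qed
  then show ?thesis
    unfolding h_poly_def by (subst eval3_homogenization) simp_all
qed

end

(*
  On a line in direction (b, 1) at which the leading form does not vanish, p restricts to a
  polynomial of degree n. In sheared coordinates these lines become x = const, and p becomes
  a polynomial in y over C[x] with constant leading coefficient. Being squarefree, it is coprime to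
  its y-derivative, so their resultant is a nonzero polynomial in x: almost all of these lines
  meet the curve in n distinct points, and each of them can be moved to infinity. So (a) and (b), which
  say that the leading coefficient times the discriminant of h does not vanish, are attained;
  joining an arbitrary polynomial or matrix by a line to one where they hold gives density.

  For the shear, t is chosen so that the derivative t h'(s) + (...) of z |-> p_h(s + t z, 1, z)
  vanishes at z = 0.
*)

theory Submission
  imports
    "Subresultants.Subresultant_Gcd"
    "HOL-Computational_Algebra.Field_as_Ring"
    Defs
begin

no_notation fps_nth (infixl "$" 75)
no_notation Matrix.vec_index (infixl "$" 100)

section \<open>Homogeneous polynomials and linear substitutions\<close>

text \<open>This is the value of p_h at a point. Later identities between polynomials are proved by
  comparing such values.\<close>

definition form_val :: "nat \<Rightarrow> complex poly poly \<Rightarrow> complex \<Rightarrow> complex \<Rightarrow> complex \<Rightarrow> complex" where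
  "form_val n p x y z = (\<Sum>i\<le>n. \<Sum>j\<le>n - i. coeff2 p i j * x ^ i * y ^ j * z ^ (n - i - j))"

lemma eval3_homogenization_form_val: "eval3 (\<lambda>c. c) (homogenization n p) x y z = form_val n p x y z"
  by (simp add: eval3_homogenization form_val_def)

text \<open>Evaluation is by plugging in constants, outermost variable first, instead of through
  \<open>map_poly\<close>; compatibility with sums and products is then immediate.\<close>

definition val3 :: "complex poly poly poly \<Rightarrow> complex \<Rightarrow> complex \<Rightarrow> complex \<Rightarrow> complex" where
  "val3 P x y z = poly (poly (poly P [:[:z:]:]) [:y:]) x"

lemma coeff3_sum: "coeff3 (sum f A) i j k = (\<Sum>a\<in>A. coeff3 (f a) i j k)"
  by (simp add: coeff3_def coeff_sum)

lemma coeff3_mult: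
  "coeff3 (P * Q) i j k =
    (\<Sum>a\<le>k. \<Sum>b\<le>j. \<Sum>c\<le>i. coeff3 P c b a * coeff3 Q (i - c) (j - b) (k - a))"
  by (simp add: coeff3_def coeff_mult coeff_sum)

lemma coeff3_const:
  "coeff3 [:[:[:c:]:]:] i j k = (if i = 0 \<and> j = 0 \<and> k = 0 then c else 0)"
  by (auto simp: coeff3_def coeff_pCons split: nat.splits)

lemma coeff3_linear_form:
  "coeff3 (linear_form a) i j k =
    (if i = 1 \<and> j = 0 \<and> k = 0 then a $ 1 else 0) +
    (if i = 0 \<and> j = 1 \<and> k = 0 then a $ 2 else 0) +
    (if i = 0 \<and> j = 0 \<and> k = 1 then a $ 3 else 0)"
  by (auto simp: coeff3_def linear_form_def coeff_pCons split: nat.splits)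

lemma coeff3_1: "coeff3 1 i j k = (if i = 0 \<and> j = 0 \<and> k = 0 then 1 else 0)"
  by (rule coeff3_const[of 1 i j k, folded one_pCons])

lemma coeff3_monom:
  "coeff3 (monom (monom (monom c a) b) d) i j k = (if i = a \<and> j = b \<and> k = d then c else 0)"
  by (auto simp: coeff3_def)

lemma coeff3_eqI: "(\<And>i j k. coeff3 P i j k = coeff3 Q i j k) \<Longrightarrow> P = Q"
  unfolding coeff3_def by (intro poly_eqI)

text \<open>The zero polynomial counts as homogeneous of every degree, so vanishing summands need no
  special treatment.\<close>

definition homogeneous3 :: "nat \<Rightarrow> complex poly poly poly \<Rightarrow> bool" where
  "homogeneous3 d P \<longleftrightarrow> (\<forall>i j k. coeff3 P i j k \<noteq> 0 \<longrightarrow> i + j + k = d)"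

lemma homogeneous3_sum: "(\<And>a. a \<in> A \<Longrightarrow> homogeneous3 d (f a)) \<Longrightarrow> homogeneous3 d (sum f A)"
  unfolding homogeneous3_def coeff3_sum by (meson sum.not_neutral_contains_not_neutral)

lemma homogeneous3_mult:
  assumes "homogeneous3 d P" "homogeneous3 e Q"
  shows "homogeneous3 (d + e) (P * Q)"
  unfolding homogeneous3_def
proof (intro allI impI)
  fix i j k
  assume "coeff3 (P * Q) i j k \<noteq> 0"
  then obtain a b c where abc: "a \<le> k" "b \<le> j" "c \<le> i"
    "coeff3 P c b a * coeff3 Q (i - c) (j - b) (k - a) \<noteq> 0"
    unfolding coeff3_mult by (metis (no_types, lifting) atMost_iff sum.neutral)
  then have "coeff3 P c b a \<noteq> 0" "coeff3 Q (i - c) (j - b) (k - a) \<noteq> 0" by auto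
  with assms have "c + b + a = d" "(i - c) + (j - b) + (k - a) = e"
    unfolding homogeneous3_def by blast+
  with abc show "i + j + k = d + e" by linarith
qed

lemma homogeneous3_const: "homogeneous3 0 [:[:[:c:]:]:]"
  by (simp add: homogeneous3_def coeff3_const)

lemma homogeneous3_linear_form: "homogeneous3 1 (linear_form a)"
  by (auto simp: homogeneous3_def coeff3_linear_form split: if_splits)

lemma homogeneous3_power: "homogeneous3 d P \<Longrightarrow> homogeneous3 (d * m) (P ^ m)"
proof (induction m)
  case 0
  show ?case by (simp add: homogeneous3_def coeff3_1)
next
  case (Suc m)
  then show ?case using homogeneous3_mult[of d P "d * m" "P ^ m"] by simp
qed

lemma linear_subst_homogenization:
  "linear_subst T (homogenization n p) =
    (\<Sum>i\<le>n. \<Sum>j\<le>n - i. [:[:[:coeff2 p i j:]:]:] *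
      linear_form (T $ 1) ^ i * linear_form (T $ 2) ^ j * linear_form (T $ 3) ^ (n - i - j))"
  unfolding linear_subst_def by (subst eval3_homogenization) simp_all

lemma homogeneous3_linear_subst: "homogeneous3 n (linear_subst T (homogenization n p))"
  unfolding linear_subst_homogenization
proof (intro homogeneous3_sum)
  fix i j
  assume "i \<in> {..n}" "j \<in> {..n - i}"
  \<comment> \<open>The degree is written in exactly the shape that the rules for constants, powers
    and products produce.\<close>
  then have "0 + 1 * i + 1 * j + 1 * (n - i - j) = n" by simp
  then show "homogeneous3 n ([:[:[:coeff2 p i j:]:]:] * linear_form (T $ 1) ^ i *
      linear_form (T $ 2) ^ j * linear_form (T $ 3) ^ (n - i - j))"
    using homogeneous3_mult homogeneous3_const homogeneous3_power homogeneous3_linear_form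
    by metis
qed

lemma coeff3_homogenization:
  "coeff3 (homogenization n p) i j k = (if i + j + k = n then coeff2 p i j else 0)"
proof -
  have "coeff3 (homogenization n p) i j k =
      (\<Sum>a\<le>n. \<Sum>b\<le>n - a. if i = a \<and> j = b \<and> k = n - a - b then coeff2 p a b else 0)"
    by (simp add: homogenization_def coeff3_sum coeff3_monom)
  also have "\<dots> = (\<Sum>a\<le>n. \<Sum>b\<le>n - a. if j = b then
      (if i = a \<and> k = n - a - b then coeff2 p a b else 0) else 0)"
    by (intro sum.cong) auto
  also have "\<dots> = (\<Sum>a\<le>n. if j \<le> n - a then
      (if i = a \<and> k = n - a - j then coeff2 p a j else 0) else 0)"
    by (subst sum.delta') simp_all
  also have "\<dots> = (\<Sum>a\<le>n. if i = a then
      (if j \<le> n - a \<and> k = n - a - j then coeff2 p a j else 0) else 0)"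
    by (intro sum.cong) auto
  also have "\<dots> = (if i + j + k = n then coeff2 p i j else 0)"
    by (subst sum.delta') auto
  finally show ?thesis .
qed

lemma coeff2_transformed:
  "coeff2 (transformed n T p) i j =
    (if i + j \<le> n then coeff3 (linear_subst T (homogenization n p)) i j (n - i - j) else 0)"
proof -
  let ?P = "linear_subst T (homogenization n p)"
  have c2: "coeff2 (sum f A) i j = (\<Sum>a\<in>A. coeff2 (f a) i j)" for f :: "nat \<Rightarrow> _" and A
    by (simp add: coeff2_def coeff_sum)
  have c2m: "coeff2 (monom (monom c a) b) i j = (if i = a \<and> j = b then c else 0)" for c a b
    by (auto simp: coeff2_def)
  have "coeff2 (transformed n T p) i j =
      (\<Sum>a\<le>n. \<Sum>b\<le>n - a. if i = a \<and> j = b then coeff3 ?P a b (n - a - b) else 0)"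
    by (simp add: transformed_def c2 c2m del: diff_diff_left)
  also have "\<dots> = (\<Sum>a\<le>n. \<Sum>b\<le>n - a. if j = b then
      (if i = a then coeff3 ?P a b (n - a - b) else 0) else 0)"
    by (intro sum.cong) auto
  also have "\<dots> = (\<Sum>a\<le>n. if j \<le> n - a then
      (if i = a then coeff3 ?P a j (n - a - j) else 0) else 0)"
    by (subst sum.delta') simp_all
  also have "\<dots> = (\<Sum>a\<le>n. if i = a then
      (if j \<le> n - a then coeff3 ?P a j (n - a - j) else 0) else 0)"
    by (intro sum.cong) auto
  also have "\<dots> = (if i + j \<le> n then coeff3 ?P i j (n - i - j) else 0)"
    by (subst sum.delta') auto
  finally show ?thesis .
qed

text \<open>\<open>transformed\<close> reads off only the coefficients at
  \<open>z ^ (n - i - j)\<close>. Nothing is lost, because the substituted form is homogeneous of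
  degree \<open>n\<close>.\<close>

lemma homogenization_transformed:
  "homogenization n (transformed n T p) = linear_subst T (homogenization n p)"
proof (rule coeff3_eqI)
  fix i j k
  show "coeff3 (homogenization n (transformed n T p)) i j k =
      coeff3 (linear_subst T (homogenization n p)) i j k"
    using homogeneous3_linear_subst[of n T p]
    by (auto simp: coeff3_homogenization coeff2_transformed homogeneous3_def)
qed

lemma val3_linear_form: "val3 (linear_form a) x y z = a $ 1 * x + a $ 2 * y + a $ 3 * z"
  by (simp add: val3_def linear_form_def algebra_simps)

lemma val3_homogenization: "val3 (homogenization n p) x y z = form_val n p x y z"
  by (simp add: val3_def homogenization_def form_val_def poly_sum poly_monom
      poly_const_pow mult_ac)

text \<open>Evaluation is a ring homomorphism, so it commutes with the substitution. The shear and
  the matrix that moves a line to infinity are both computed through this identity.\<close>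

lemma form_val_transformed:
  "form_val n (transformed n T p) x y z =
    form_val n p (T $ 1 $ 1 * x + T $ 1 $ 2 * y + T $ 1 $ 3 * z)
      (T $ 2 $ 1 * x + T $ 2 $ 2 * y + T $ 2 $ 3 * z)
      (T $ 3 $ 1 * x + T $ 3 $ 2 * y + T $ 3 $ 3 * z)"
proof -
  have hom: "val3 (sum f A) x y z = (\<Sum>a\<in>A. val3 (f a) x y z)"
    "val3 (P * Q) x y z = val3 P x y z * val3 Q x y z"
    "val3 (P ^ m) x y z = val3 P x y z ^ m"
    "val3 [:[:[:c:]:]:] x y z = c"
    for f :: "nat \<Rightarrow> _" and A P Q m c
    by (simp_all add: val3_def poly_sum)
  have "form_val n (transformed n T p) x y z = val3 (linear_subst T (homogenization n p)) x y z"
    by (simp only: val3_homogenization[symmetric] homogenization_transformed)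
  then show ?thesis
    by (simp only: linear_subst_homogenization hom val3_linear_form form_val_def)
qed

lemma poly_ext:
  fixes p q :: "'a :: {idom, ring_char_0} poly"
  shows "(\<And>x. poly p x = poly q x) \<Longrightarrow> p = q"
  by (simp add: poly_eq_poly_eq_iff[symmetric] fun_eq_iff)

lemma poly_h_poly: "poly (h_poly n p) x = form_val n p x 1 0"
proof -
  have "(\<Sum>j\<le>n - i. coeff2 p i j * x ^ i * 1 ^ j * 0 ^ (n - i - j)) = coeff2 p i (n - i) * x ^ i"
    if "i \<le> n" for i
  proof -
    have "(\<Sum>j\<le>n - i. coeff2 p i j * x ^ i * 1 ^ j * 0 ^ (n - i - j)) =
        (\<Sum>j\<in>{n - i}. coeff2 p i j * x ^ i)"
      by (rule sum.mono_neutral_cong_right) (auto simp: power_0_left)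
    then show ?thesis by simp
  qed
  then show ?thesis
    by (simp add: h_poly_eq form_val_def poly_sum poly_monom)
qed

lemma coeff_h_poly: "coeff (h_poly n p) i = (if i \<le> n then coeff2 p i (n - i) else 0)"
  by (simp add: h_poly_eq coeff_sum)

text \<open>With 0^0 = 1, only the term with j = 0 and i = n survives.\<close>

lemma form_val_x: "form_val n p 1 0 0 = coeff2 p n 0"
proof -
  have "form_val n p 1 0 0 = (\<Sum>i\<le>n. \<Sum>j\<le>n - i. if 0 = j then coeff2 p i j * 0 ^ (n - i) else 0)"
    unfolding form_val_def by (intro sum.cong) (auto simp: power_0_left)
  also have "\<dots> = (\<Sum>i\<le>n. coeff2 p i 0 * 0 ^ (n - i))"
    by (subst sum.delta') simp_all
  also have "\<dots> = (\<Sum>i\<le>n. if n = i then coeff2 p i 0 else 0)"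
    by (intro sum.cong) (auto simp: power_0_left)
  finally show ?thesis by simp
qed

section \<open>The line at infinity and the shear\<close>

lemma degree_eq_sum_order:
  fixes p :: "complex poly"
  assumes "p \<noteq> 0"
  shows "degree p = (\<Sum>z | poly p z = 0. order z p)"
proof -
  have "degree p = degree (\<Prod>z | poly p z = 0. [:-z, 1:] ^ order z p)"
    using assms by (subst complex_poly_decompose[symmetric]) simp
  also have "\<dots> = (\<Sum>z | poly p z = 0. order z p)"
    by (subst degree_prod_sum_eq) (simp_all add: degree_power_eq)
  finally show ?thesis .
qed

text \<open>The degree is the sum of the orders of the roots. Each order is at least 1, so the sum
  equals the number of roots exactly when every order is 1.\<close>

lemma rsquarefree_iff_card_roots:
  fixes p :: "complex poly"
  assumes "p \<noteq> 0"
  shows "rsquarefree p \<longleftrightarrow> card {z. poly p z = 0} = degree p"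
proof
  assume "rsquarefree p"
  then have "(\<Sum>z | poly p z = 0. order z p) = (\<Sum>z | poly p z = 0. 1)"
    using assms by (intro sum.cong) (auto simp: rsquarefree_root_order)
  then show "card {z. poly p z = 0} = degree p"
    by (simp add: degree_eq_sum_order[OF assms])
next
  assume card: "card {z. poly p z = 0} = degree p"
  have pos: "1 \<le> order z p" if "poly p z = 0" for z
    using that assms by (simp add: Suc_le_eq order_root)
  show "rsquarefree p"
  proof (rule ccontr)
    assume "\<not> rsquarefree p"
    then obtain z where z: "order z p \<noteq> 0" "order z p \<noteq> 1"
      using assms by (auto simp: rsquarefree_def)
    then have "poly p z = 0" by (simp add: order_root)
    then have "(\<Sum>z | poly p z = 0. 1) < (\<Sum>z | poly p z = 0. order z p)"
      using z pos assms poly_roots_finite[OF assms]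
      by (intro sum_strict_mono_ex1) (auto intro!: bexI[of _ z])
    then show False using card by (simp add: degree_eq_sum_order[OF assms])
  qed
qed

lemma form_val_scale: "form_val n p (c * x) (c * y) (c * z) = c ^ n * form_val n p x y z"
  unfolding form_val_def sum_distrib_left
proof (intro sum.cong refl)
  fix i j
  assume "i \<in> {..n}" "j \<in> {..n - i}"
  then have "c ^ n = c ^ i * c ^ j * c ^ (n - i - j)"
    by (simp flip: power_add)
  then show "coeff2 p i j * (c * x) ^ i * (c * y) ^ j * (c * z) ^ (n - i - j) =
      c ^ n * (coeff2 p i j * x ^ i * y ^ j * z ^ (n - i - j))"
    by (simp only: power_mult_distrib) simp
qed

lemma degree_h_poly: "prop_a n p \<Longrightarrow> degree (h_poly n p) = n"
  by (intro antisym degree_le le_degree) (auto simp: prop_a_def coeff_h_poly)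

lemma h_poly_nonzero: "prop_a n p \<Longrightarrow> h_poly n p \<noteq> 0"
  by (metis coeff_0 coeff_h_poly diff_self_eq_0 le_refl prop_a_def)

text \<open>The second coordinate 1 forces the scaling factor to be 1.\<close>

lemma proj_point_affine_inj: "inj (\<lambda>x :: complex. proj_point (vector [x, 1, 0]))"
proof (rule injI)
  fix x y :: complex
  assume eq: "proj_point (vector [x, 1, 0]) = proj_point (vector [y, 1, 0])"
  have "vector [x, 1, 0] \<in> proj_point (vector [x, 1, 0])"
    unfolding proj_point_def by (rule CollectI, rule exI[of _ 1]) simp
  then obtain c where "vector [x, 1, 0] = c *s (vector [y, 1, 0] :: complex ^ 3)"
    unfolding eq by (auto simp: proj_point_def)
  then show "x = y"
    by (simp add: vec_eq_iff forall_3)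
qed

lemma proj_point_scale: "c \<noteq> 0 \<Longrightarrow> proj_point (c *s w) = proj_point w"
proof -
  assume c: "c \<noteq> 0"
  have "d *s w = (d / c) *s (c *s w)" "d *s (c *s w) = (d * c) *s w" for d
    using c by (simp_all add: vector_smult_assoc)
  then have "x \<in> proj_point (c *s w) \<longleftrightarrow> x \<in> proj_point w" for x
    unfolding proj_point_def mem_Collect_eq using c
    by (metis divide_eq_0_iff mult_eq_0_iff)
  then show ?thesis by blast
qed

text \<open>By (a) the point [1 : 0 : 0] is not on the curve, so every point at infinity has a
  representative with second coordinate 1, and its first coordinate is a zero of h.\<close>

lemma points_at_infinity_eq:
  assumes "prop_a n p"
  shows "points_at_infinity n p =
    (\<lambda>x. proj_point (vector [x, 1, 0])) ` {x. poly (h_poly n p) x = 0}"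
proof (intro equalityI subsetI)
  fix P
  assume "P \<in> points_at_infinity n p"
  then obtain w where w: "P = proj_point w" "w \<noteq> 0" "w $ 3 = 0"
    "form_val n p (w $ 1) (w $ 2) 0 = 0"
    by (auto simp: points_at_infinity_def eval3_homogenization_form_val)
  have w2: "w $ 2 \<noteq> 0"
  proof
    assume 0: "w $ 2 = 0"
    with w have "w $ 1 \<noteq> 0" by (auto simp: vec_eq_iff forall_3)
    moreover have "form_val n p (w $ 1) (w $ 2) 0 = (w $ 1) ^ n * coeff2 p n 0"
      using form_val_scale[of n p "w $ 1" 1 0 0] 0 by (simp add: form_val_x)
    ultimately show False using w assms by (simp add: prop_a_def)
  qed
  let ?x = "w $ 1 / w $ 2"
  have "w = w $ 2 *s vector [?x, 1, 0]"
    using w w2 by (simp add: vec_eq_iff forall_3)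
  then have "P = proj_point (vector [?x, 1, 0])"
    using w w2 proj_point_scale by metis
  moreover have "poly (h_poly n p) ?x = 0"
    using form_val_scale[of n p "w $ 2" ?x 1 0] w w2 by (simp add: poly_h_poly)
  ultimately show "P \<in> (\<lambda>x. proj_point (vector [x, 1, 0])) ` {x. poly (h_poly n p) x = 0}"
    by blast
next
  fix P
  assume "P \<in> (\<lambda>x. proj_point (vector [x, 1, 0])) ` {x. poly (h_poly n p) x = 0}"
  then obtain x where x: "P = proj_point (vector [x, 1, 0])" "form_val n p x 1 0 = 0"
    by (auto simp: poly_h_poly)
  then show "P \<in> points_at_infinity n p"
    unfolding points_at_infinity_def eval3_homogenization_form_val
    by (intro CollectI exI[of _ "vector [x, 1, 0]"]) (auto simp: vec_eq_iff forall_3)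
qed

lemma prop_b_iff_card_points_at_infinity:
  assumes "prop_a n p"
  shows "prop_b n p \<longleftrightarrow> card (points_at_infinity n p) = n"
proof -
  have "card (points_at_infinity n p) = card {x. poly (h_poly n p) x = 0}"
    unfolding points_at_infinity_eq[OF assms]
    by (rule card_image) (rule inj_on_subset[OF proj_point_affine_inj], simp)
  then show ?thesis
    using rsquarefree_iff_card_roots[OF h_poly_nonzero[OF assms]] degree_h_poly[OF assms]
    by (simp add: prop_b_def)
qed

section \<open>The shear at a root of h\<close>

lemma form_val_shear:
  "form_val n (transformed n (shear s t) p) x y z = form_val n p (x + s * y + t * z) y z"
  by (simp add: form_val_transformed shear_def)

text \<open>On the line z = 0 the parameter \<open>t\<close> drops out, which leaves the translation
  by \<open>s\<close>.\<close>

lemma h_poly_shear: "h_poly n (transformed n (shear s t) p) = pcompose (h_poly n p) [:s, 1:]"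
  by (rule poly_ext) (simp add: poly_h_poly form_val_shear poly_pcompose add.commute)

lemma linear_poly_power_coeffs:
  fixes s t :: "'a :: comm_ring_1"
  shows "coeff ([:s, t:] ^ i) 0 = s ^ i"
    and "coeff ([:s, t:] ^ i) 1 = of_nat i * s ^ (i - 1) * t"
proof -
  show 0: "coeff ([:s, t:] ^ i) 0 = s ^ i" for i
    by (induction i) (simp_all add: coeff_mult_0)
  show "coeff ([:s, t:] ^ i) 1 = of_nat i * s ^ (i - 1) * t"
  proof (induction i)
    case (Suc i)
    have "coeff ([:s, t:] ^ Suc i) 1 = s * coeff ([:s, t:] ^ i) 1 + t * coeff ([:s, t:] ^ i) 0"
      by (simp add: coeff_pCons)
    with Suc 0 show ?case by (cases i) (simp_all add: algebra_simps)
  qed simp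
qed

text \<open>This is z |-> p_h(s + t z, 1, z) as a polynomial in z: the restriction of p_h to a line
  through the point [s : 1 : 0] at infinity.\<close>

definition form_along_line :: "nat \<Rightarrow> complex poly poly \<Rightarrow> complex \<Rightarrow> complex \<Rightarrow> complex poly" where
  "form_along_line n p s t =
    (\<Sum>i\<le>n. \<Sum>j\<le>n - i. smult (coeff2 p i j) (monom 1 (n - i - j) * [:s, t:] ^ i))"

lemma poly_form_along_line: "poly (form_along_line n p s t) z = form_val n p (s + t * z) 1 z"
  by (simp add: form_along_line_def form_val_def poly_sum poly_monom mult_ac)

text \<open>The linear coefficient is the derivative at z = 0. The first argument moves with
  velocity \<open>t\<close> and contributes t h'(s); the explicit z contributes the coefficients
  with i + j = n - 1.\<close>

lemma coeff_1_form_along_line: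
  assumes "1 \<le> n"
  shows "coeff (form_along_line n p s t) 1 =
    t * poly (pderiv (h_poly n p)) s + (\<Sum>i<n. coeff2 p i (n - 1 - i) * s ^ i)"
proof -
  have inner: "(\<Sum>j\<le>n - i. coeff2 p i j * coeff (monom 1 (n - i - j) * [:s, t:] ^ i) 1) =
      t * (coeff2 p i (n - i) * (of_nat i * s ^ (i - 1))) +
      (if i < n then coeff2 p i (n - 1 - i) * s ^ i else 0)" (is "?L = _") if i: "i \<le> n" for i
  proof -
    \<comment> \<open>Terms divisible by z^2 drop out. For i = n the truncated difference
      \<open>n - 1 - i\<close> is 0 and would coincide with \<open>n - i\<close>; the test
      \<open>i < n\<close> keeps that term from being counted twice.\<close>
    have "?L = (\<Sum>j\<le>n - i.
        (if j = n - i then t * (coeff2 p i j * (of_nat i * s ^ (i - 1))) else 0) +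
        (if j = n - 1 - i then (if i < n then coeff2 p i j * s ^ i else 0) else 0))"
    proof (intro sum.cong refl)
      fix j assume j: "j \<in> {..n - i}"
      consider "j = n - i" | "i < n" "j = n - 1 - i" | "n - i - j > 1"
        using i j by (cases "i = n") (auto, linarith)
      then show "coeff2 p i j * coeff (monom 1 (n - i - j) * [:s, t:] ^ i) 1 =
        (if j = n - i then t * (coeff2 p i j * (of_nat i * s ^ (i - 1))) else 0) +
        (if j = n - 1 - i then (if i < n then coeff2 p i j * s ^ i else 0) else 0)"
      proof cases
        case 1
        then show ?thesis
          using linear_poly_power_coeffs(2)[of s t i] i by (auto simp: coeff_monom_mult)
      next
        case 2
        then have "n - i - j = 1" by simp
        then show ?thesis
          using linear_poly_power_coeffs(1)[of s t i] 2 by (auto simp: coeff_monom_mult)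
      next
        case 3
        then show ?thesis by (auto simp: coeff_monom_mult)
      qed
    qed
    also have "\<dots> = t * (coeff2 p i (n - i) * (of_nat i * s ^ (i - 1))) +
      (if i < n then coeff2 p i (n - 1 - i) * s ^ i else 0)"
      by (auto simp: sum.distrib)
    finally show ?thesis .
  qed
  have "coeff (form_along_line n p s t) 1 =
      (\<Sum>i\<le>n. t * (coeff2 p i (n - i) * (of_nat i * s ^ (i - 1))) +
        (if i < n then coeff2 p i (n - 1 - i) * s ^ i else 0))"
    unfolding form_along_line_def coeff_sum coeff_smult by (intro sum.cong refl inner) simp
  also have "\<dots> = t * (\<Sum>i\<le>n. coeff2 p i (n - i) * (of_nat i * s ^ (i - 1))) +
      (\<Sum>i\<le>n. if i < n then coeff2 p i (n - 1 - i) * s ^ i else 0)"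
    by (simp add: sum.distrib sum_distrib_left)
  also have "(\<Sum>i\<le>n. coeff2 p i (n - i) * (of_nat i * s ^ (i - 1))) = poly (pderiv (h_poly n p)) s"
    by (simp add: h_poly_eq pderiv_sum pderiv_monom poly_sum poly_monom mult_ac)
  also have "(\<Sum>i\<le>n. if i < n then coeff2 p i (n - 1 - i) * s ^ i else 0) =
      (\<Sum>i<n. coeff2 p i (n - 1 - i) * s ^ i)"
    by (rule sum.mono_neutral_cong_right) auto
  finally show ?thesis .
qed

lemma form_along_line_shear:
  "form_along_line n (transformed n (shear s t) p) 0 0 = form_along_line n p s t"
  by (rule poly_ext) (simp add: poly_form_along_line form_val_shear)

text \<open>In the new coordinates this coefficient is the linear one along the line x = 0, y = 1,
  which the shear carries to z |-> (s + t z, 1, z). The value \<open>t_value\<close> solves the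
  linear equation in \<open>t\<close> that makes it vanish.\<close>

lemma coeff2_shear_penultimate:
  assumes "1 \<le> n" and "poly (pderiv (h_poly n p)) s \<noteq> 0"
  shows "coeff2 (transformed n (shear s (t_value n p s)) p) 0 (n - 1) = 0"
proof -
  let ?q = "transformed n (shear s (t_value n p s)) p"
  have "coeff2 ?q 0 (n - 1) = (\<Sum>i<n. coeff2 ?q i (n - 1 - i) * 0 ^ i)"
    using assms(1) by (subst sum.mono_neutral_right[of _ "{0}"]) (auto simp: power_0_left)
  also have "\<dots> = coeff (form_along_line n ?q 0 0) 1"
    by (subst coeff_1_form_along_line[OF assms(1)]) simp
  also have "\<dots> = t_value n p s * poly (pderiv (h_poly n p)) s +
      (\<Sum>i<n. coeff2 p i (n - 1 - i) * s ^ i)"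
    unfolding form_along_line_shear by (rule coeff_1_form_along_line[OF assms(1)])
  also have "\<dots> = 0" using assms(2) by (simp add: t_value_def)
  finally show ?thesis .
qed

lemma shear_prop_a: "coeff2 (transformed n (shear s t) p) n 0 = coeff2 p n 0"
  using form_val_shear[of n s t p 1 0 0] by (simp add: form_val_x)

text \<open>A common zero of the shifted h and its derivative would be a shifted common zero of h
  and h'.\<close>

lemma shear_prop_b: "prop_b n p \<Longrightarrow> prop_b n (transformed n (shear s t) p)"
  by (simp add: prop_b_def rsquarefree_roots h_poly_shear pderiv_pcompose poly_pcompose
      pderiv_pCons)

lemma coeff2_shear_last:
  assumes "poly (h_poly n p) s = 0"
  shows "coeff2 (transformed n (shear s t) p) 0 n = 0"
proof -
  let ?q = "transformed n (shear s t) p"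
  have "coeff2 ?q 0 n = poly (h_poly n ?q) 0"
    by (simp add: poly_0_coeff_0 coeff_h_poly)
  also have "\<dots> = 0" using assms by (simp add: h_poly_shear poly_pcompose)
  finally show ?thesis .
qed

lemma shear_step:
  assumes "1 \<le> n" "prop_a n p" "prop_b n p" "poly (h_poly n p) s = 0"
  shows "poly (pderiv (h_poly n p)) s \<noteq> 0 \<and>
          (let q = transformed n (shear s (t_value n p s)) p in
            coeff2 q 0 n = 0 \<and> coeff2 q 0 (n - 1) = 0 \<and>
            coeff2 q n 0 = coeff2 p n 0 \<and> prop_a n q \<and> prop_b n q \<and>
            (\<forall>\<xi>. eval3 (\<lambda>c. c) (homogenization n q) \<xi> 1 0 =
                 eval3 (\<lambda>c. c) (homogenization n p) (\<xi> + s) 1 0) \<and>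
            {\<xi>. poly (h_poly n q) \<xi> = 0} = (\<lambda>\<xi>. \<xi> - s) ` {\<xi>. poly (h_poly n p) \<xi> = 0})"
proof -
  have d: "poly (pderiv (h_poly n p)) s \<noteq> 0"
    using assms(3,4) by (auto simp: prop_b_def rsquarefree_roots)
  moreover have "{x. poly (h_poly n (transformed n (shear s t) p)) x = 0} =
      (\<lambda>x. x - s) ` {x. poly (h_poly n p) x = 0}" for t
    by (auto simp: h_poly_shear poly_pcompose image_iff algebra_simps
        intro!: exI[of _ "s + _"])
  ultimately show ?thesis
    using assms coeff2_shear_last coeff2_shear_penultimate[OF assms(1) d] shear_prop_a shear_prop_b
    by (simp add: Let_def prop_a_def eval3_homogenization_form_val form_val_shear)
qed

section \<open>The cofactor v of the root 0 of h\<close>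

lemma h_poly_eq_pCons_v_poly:
  assumes "1 \<le> n" and "coeff2 p 0 n = 0"
  shows "h_poly n p = pCons 0 (v_poly n p)"
  by (rule poly_eqI)
    (use assms in \<open>auto simp: coeff_h_poly coeff_pCons v_poly_def coeff_sum split: nat.splits\<close>)

text \<open>Here h = \<xi> v and h' = v + \<xi> v'. Hence h'(0) = v(0), and a common zero of v and
  v' is a common zero of h and h'.\<close>

lemma v_poly_simple_nonzero:
  assumes "1 \<le> n" "coeff2 p 0 n = 0" "prop_b n p"
  shows "rsquarefree (v_poly n p)" "poly (v_poly n p) 0 \<noteq> 0"
proof -
  have "\<not> (poly (pCons 0 (v_poly n p)) a = 0 \<and> poly (pderiv (pCons 0 (v_poly n p))) a = 0)" for a
    using assms unfolding prop_b_def h_poly_eq_pCons_v_poly[OF assms(1,2)] rsquarefree_roots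
    by blast
  then have *: "\<not> (a * poly (v_poly n p) a = 0 \<and>
      poly (v_poly n p) a + a * poly (pderiv (v_poly n p)) a = 0)" for a
    by (simp add: pderiv_pCons)
  show "poly (v_poly n p) 0 \<noteq> 0" using *[of 0] by simp
  show "rsquarefree (v_poly n p)" unfolding rsquarefree_roots using * by force
qed

section \<open>Polynomial functions and genericity\<close>

lemma polynomial_functions_sum:
  "(\<And>a. a \<in> A \<Longrightarrow> (\<lambda>u. f a u) \<in> polynomial_functions C) \<Longrightarrow>
    (\<lambda>u. \<Sum>a\<in>A. f a u) \<in> polynomial_functions C"
  by (induction A rule: infinite_finite_induct) (auto intro: polynomial_functions.intros)

lemma polynomial_functions_prod:
  "(\<And>a. a \<in> A \<Longrightarrow> (\<lambda>u. f a u) \<in> polynomial_functions C) \<Longrightarrow>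
    (\<lambda>u. \<Prod>a\<in>A. f a u) \<in> polynomial_functions C"
  by (induction A rule: infinite_finite_induct) (auto intro: polynomial_functions.intros)

lemma polynomial_functions_compose:
  assumes "f \<in> polynomial_functions C"
    and "\<And>g. g \<in> C \<Longrightarrow> (\<lambda>u. g (\<phi> u)) \<in> polynomial_functions D"
  shows "(\<lambda>u. f (\<phi> u)) \<in> polynomial_functions D"
  using assms(1) by induction (auto intro: polynomial_functions.intros assms(2))

text \<open>Restricted to a line, polynomial functions thus become elements of the integral domain
  C[u].\<close>

lemma polynomial_functions_id:
  assumes "f \<in> polynomial_functions {\<lambda>u. u}"
  shows "\<exists>P. f = poly P"
  using assms
proof induction
  case (const c)
  show ?case by (rule exI[of _ "[:c:]"]) auto
next
  case (coord f)
  then show ?case by (intro exI[of _ "[:0, 1:]"]) auto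
next
  case (add f g)
  then obtain P Q where "f = poly P" "g = poly Q" by blast
  then show ?case by (intro exI[of _ "P + Q"]) auto
next
  case (mult f g)
  then obtain P Q where "f = poly P" "g = poly Q" by blast
  then show ?case by (intro exI[of _ "P * Q"]) auto
qed

text \<open>Density is tested on lines: every point of \<open>X\<close> is joined to the single witness \<open>w\<close>, and on
  each such line \<open>\<Phi>\<close> has only finitely many zeros.\<close>

lemma generic_via_lines:
  fixes L :: "'a \<Rightarrow> complex \<Rightarrow> 'a"
  assumes \<Phi>: "\<Phi> \<in> polynomial_functions C" "\<Phi> w \<noteq> 0"
    and Q: "\<And>u. u \<in> X \<Longrightarrow> \<Phi> u \<noteq> 0 \<Longrightarrow> Q u"
    and ends: "\<And>x. L x 0 = x" "\<And>x g. g \<in> C \<Longrightarrow> g (L x 1) = g w"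
    and poly: "\<And>x g. g \<in> C \<Longrightarrow> (\<lambda>u. g (L x u)) \<in> polynomial_functions {\<lambda>u. u}"
    and mem: "\<And>x u. x \<in> X \<Longrightarrow> \<Phi> (L x u) \<noteq> 0 \<Longrightarrow> L x u \<in> X"
  shows "generic C X Q"
  unfolding generic_def
proof (intro bexI[OF _ \<Phi>(1)] conjI ballI impI)
  fix \<Psi> x
  assume \<Psi>: "\<Psi> \<in> polynomial_functions C" "\<forall>u\<in>X. \<Phi> u \<noteq> 0 \<longrightarrow> \<Psi> u = 0" and x: "x \<in> X"
  obtain P where P: "(\<lambda>u. \<Phi> (L x u)) = poly P"
    using polynomial_functions_id polynomial_functions_compose[where \<phi> = "L x", OF \<Phi>(1) poly] by blast
  obtain R where R: "(\<lambda>u. \<Psi> (L x u)) = poly R"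
    using polynomial_functions_id polynomial_functions_compose[where \<phi> = "L x", OF \<Psi>(1) poly] by blast
  \<comment> \<open>Agreement at the end of the line is assumed for coordinate functions only;
    induction extends it to all polynomial functions.\<close>
  have "f (L x 1) = f w" if "f \<in> polynomial_functions C" for f
    using that by induction (auto simp: ends)
  then have "poly P 1 \<noteq> 0" using \<Phi> P by (metis)
  then have "P \<noteq> 0" by auto
  \<comment> \<open>At each \<open>u\<close> either \<open>P\<close> vanishes, or
    \<open>L x u\<close> lies in \<open>X\<close> with \<open>\<Phi>\<close> nonzero there and
    \<open>R\<close> vanishes. The product is therefore zero, and so is one factor.\<close>
  moreover have "poly (P * R) u = poly 0 u" for u
    using \<Psi>(2)[rule_format, of "L x u"] mem[OF x, of u] fun_cong[OF P, of u] fun_cong[OF R, of u] by auto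
  then have "P * R = 0" by (rule poly_ext)
  ultimately have "R = 0" by simp
  then show "\<Psi> x = 0" using fun_cong[OF R, of 0] by (simp add: ends)
qed (use Q in auto)

section \<open>Polynomial dependence on the matrix entries\<close>

definition polynomial_family :: "('a \<Rightarrow> complex) set \<Rightarrow> ('a \<Rightarrow> complex poly poly poly) \<Rightarrow> bool" where
  "polynomial_family C P \<longleftrightarrow> (\<forall>i j k. (\<lambda>u. coeff3 (P u) i j k) \<in> polynomial_functions C)"

lemma polynomial_family_sum:
  "(\<And>a. a \<in> A \<Longrightarrow> polynomial_family C (\<lambda>u. f a u)) \<Longrightarrow> polynomial_family C (\<lambda>u. \<Sum>a\<in>A. f a u)"
  by (simp add: polynomial_family_def coeff3_sum polynomial_functions_sum)

lemma polynomial_family_const: "polynomial_family C (\<lambda>_. P)"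
  by (simp add: polynomial_family_def polynomial_functions.const)

lemma polynomial_family_mult:
  "polynomial_family C P \<Longrightarrow> polynomial_family C Q \<Longrightarrow> polynomial_family C (\<lambda>u. P u * Q u)"
  unfolding polynomial_family_def coeff3_mult
  by (intro allI polynomial_functions_sum polynomial_functions.mult) auto

lemma polynomial_family_power:
  "polynomial_family C P \<Longrightarrow> polynomial_family C (\<lambda>u. P u ^ m)"
  by (induction m) (auto intro: polynomial_family_mult polynomial_family_const)

lemma polynomial_family_linear_form:
  "polynomial_family entry_functions (\<lambda>T. linear_form (T $ r))"
proof -
  have entry: "(\<lambda>T. T $ r $ c) \<in> polynomial_functions entry_functions" for c
    by (rule polynomial_functions.coord) (auto simp: entry_functions_def)
  have "(\<lambda>T. if b then T $ r $ c else 0) \<in> polynomial_functions entry_functions" for c b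
    using entry[of c] polynomial_functions.const[of 0] by (cases b) auto
  then show ?thesis
    unfolding polynomial_family_def coeff3_linear_form
    by (intro allI polynomial_functions.add)
qed

text \<open>The substituted form arises by sums and products from constants and from linear forms
  whose coefficients are entries of \<open>T\<close>.\<close>

lemma coeff2_transformed_polynomial:
  "(\<lambda>T. coeff2 (transformed n T p) i j) \<in> polynomial_functions entry_functions"
proof -
  have "polynomial_family entry_functions (\<lambda>T. linear_subst T (homogenization n p))"
    unfolding linear_subst_homogenization
    by (intro polynomial_family_sum polynomial_family_mult polynomial_family_power
        polynomial_family_linear_form polynomial_family_const)
  then show ?thesis
    unfolding coeff2_transformed polynomial_family_def
    by (cases "i + j \<le> n") (auto intro: polynomial_functions.const)
qed

lemma det_polynomial: "(\<lambda>T. det T) \<in> polynomial_functions entry_functions"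
proof -
  have entry: "(\<lambda>T. T $ r $ c) \<in> polynomial_functions entry_functions" for r c
    by (rule polynomial_functions.coord) (auto simp: entry_functions_def)
  show ?thesis
    unfolding det_def
    by (intro polynomial_functions_sum polynomial_functions.mult polynomial_functions_prod
        polynomial_functions.const entry)
qed

section \<open>Squarefreeness\<close>

lemma coeff2_mult:
  "coeff2 (p * q) i j = (\<Sum>b\<le>j. \<Sum>a\<le>i. coeff2 p a b * coeff2 q (i - a) (j - b))"
  by (simp add: coeff2_def coeff_mult coeff_sum)

lemma coeff2_mult_eq_0:
  assumes "\<And>i j. coeff2 p i j \<noteq> 0 \<Longrightarrow> i + j \<le> d" "\<And>i j. coeff2 q i j \<noteq> 0 \<Longrightarrow> i + j \<le> e"
    and "i + j > d + e"
  shows "coeff2 (p * q) i j = 0"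
  unfolding coeff2_mult
proof (intro sum.neutral ballI)
  fix a b assume ab: "b \<in> {..j}" "a \<in> {..i}"
  show "coeff2 p a b * coeff2 q (i - a) (j - b) = 0"
  proof (rule ccontr)
    assume "coeff2 p a b * coeff2 q (i - a) (j - b) \<noteq> 0"
    then have "a + b \<le> d" "(i - a) + (j - b) \<le> e" using assms(1,2) by auto
    with ab assms(3) show False by auto
  qed
qed

definition val2 :: "complex poly poly \<Rightarrow> complex \<Rightarrow> complex \<Rightarrow> complex" where
  "val2 p x y = poly (poly p [:y:]) x"

lemma val2_mult: "val2 (p * q) x y = val2 p x y * val2 q x y"
  by (simp add: val2_def)

text \<open>A nonzero element of C[x][y] has only finitely many roots in C[x], whereas every
  constant \<open>[:y:]\<close> would be a root of the difference.\<close>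

lemma val2_ext:
  assumes "\<And>x y. val2 p x y = val2 q x y"
  shows "p = q"
proof (rule ccontr)
  assume "p \<noteq> q"
  then have "finite {c. poly (p - q) c = 0}" by (intro poly_roots_finite) simp
  moreover have "poly (p - q) [:y:] = 0" for y
    using assms by (intro poly_ext) (simp add: val2_def)
  then have "range (\<lambda>y. [:y:]) \<subseteq> {c. poly (p - q) c = 0}" by auto
  moreover have "infinite (range (\<lambda>y :: complex. [:y:]))"
    using infinite_UNIV_char_0 by (subst finite_image_iff) (auto simp: inj_def)
  ultimately show False using finite_subset by blast
qed

lemma coeff2_sum: "coeff2 (sum f A) i j = (\<Sum>a\<in>A. coeff2 (f a) i j)"
  by (simp add: coeff2_def coeff_sum)

lemma poly2_eq_sum_monom:
  assumes "\<And>i j. coeff2 p i j \<noteq> 0 \<Longrightarrow> i + j \<le> n"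
  shows "p = (\<Sum>i\<le>n. \<Sum>j\<le>n - i. monom (monom (coeff2 p i j) i) j)" (is "p = ?q")
proof (rule poly_eqI, rule poly_eqI)
  fix j i
  have "coeff2 ?q i j = (\<Sum>a\<le>n. \<Sum>b\<le>n - a. if j = b then (if i = a then coeff2 p a b else 0) else 0)"
    unfolding coeff2_sum by (intro sum.cong) (auto simp: coeff2_def)
  also have "\<dots> = (\<Sum>a\<le>n. if j \<le> n - a then (if i = a then coeff2 p a j else 0) else 0)"
    by (subst sum.delta') simp_all
  also have "\<dots> = (\<Sum>a\<le>n. if i = a then (if j \<le> n - a then coeff2 p a j else 0) else 0)"
    by (intro sum.cong) auto
  also have "\<dots> = coeff2 p i j"
    using assms[of i j] by (cases "coeff2 p i j = 0") (auto simp: sum.delta')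
  finally show "coeff (coeff p j) i = coeff (coeff ?q j) i" by (simp add: coeff2_def)
qed

text \<open>This is dehomogenization at z = 1; the degree bound guarantees that the sum in
  \<open>form_val\<close> reaches every coefficient.\<close>

lemma val2_eq_form_val:
  assumes "\<And>i j. coeff2 p i j \<noteq> 0 \<Longrightarrow> i + j \<le> n"
  shows "val2 p x y = form_val n p x y 1"
  by (subst poly2_eq_sum_monom[OF assms], assumption)
    (simp add: val2_def form_val_def poly_sum poly_monom poly_const_pow mult_ac)

text \<open>For z \<noteq> 0 the value p_h(x, 1, z) is z^d p(x/z, 1/z), which is multiplicative.
  Both sides are polynomials in z, so the identity extends to z = 0, where it concerns the leading
  forms.\<close>

lemma h_poly_mult:
  assumes "\<And>i j. coeff2 p i j \<noteq> 0 \<Longrightarrow> i + j \<le> d" "\<And>i j. coeff2 q i j \<noteq> 0 \<Longrightarrow> i + j \<le> e"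
  shows "h_poly (d + e) (p * q) = h_poly d p * h_poly e q"
proof (rule poly_ext)
  fix x
  let ?P = "form_along_line d p x 0" and ?Q = "form_along_line e q x 0"
    and ?R = "form_along_line (d + e) (p * q) x 0"
  have dehom: "form_val m r x 1 z = z ^ m * val2 r (x / z) (1 / z)"
    if "\<And>i j. coeff2 r i j \<noteq> 0 \<Longrightarrow> i + j \<le> m" "z \<noteq> 0" for m r z
    using form_val_scale[of m r z "x / z" "1 / z" 1] val2_eq_form_val[OF that(1)] that(2) by simp
  have pq: "i + j \<le> d + e" if "coeff2 (p * q) i j \<noteq> 0" for i j
    using coeff2_mult_eq_0[OF assms] that by (meson not_le)
  \<comment> \<open>The extra factor z makes the identity trivial at z = 0, so that it holds for all
    z and the factor can be cancelled afterwards.\<close>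
  have "poly ([:0, 1:] * ?R) z = poly ([:0, 1:] * (?P * ?Q)) z" for z
  proof (cases "z = 0")
    case False
    then show ?thesis
      using dehom[OF assms(1) False] dehom[OF assms(2) False] dehom[OF pq False]
      by (simp add: poly_form_along_line val2_mult power_add)
  qed simp
  then have "[:0, 1:] * ?R = [:0, 1:] * (?P * ?Q)" by (rule poly_ext)
  then have "?R = ?P * ?Q" by simp
  then have "poly ?R 0 = poly ?P 0 * poly ?Q 0" by simp
  then show "poly (h_poly (d + e) (p * q)) x = poly (h_poly d p * h_poly e q) x"
    by (simp add: poly_form_along_line poly_h_poly)
qed

lemma total_degree_exists:
  assumes "p \<noteq> 0"
  shows "\<exists>d. has_total_degree p d"
proof -
  define S where "S m \<longleftrightarrow> (\<exists>i j. i + j = m \<and> coeff2 p i j \<noteq> 0)" for m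
  have "coeff2 p (degree (lead_coeff p)) (degree p) \<noteq> 0"
    using assms by (simp add: coeff2_def)
  then have ex: "\<exists>m. S m" unfolding S_def by blast
  \<comment> \<open>A crude bound, serving only to make the greatest degree exist.\<close>
  have bound: "m \<le> (\<Sum>j\<le>degree p. degree (coeff p j)) + degree p" if m: "S m" for m
  proof -
    obtain i j where ij: "m = i + j" "coeff (coeff p j) i \<noteq> 0"
      using m unfolding S_def coeff2_def by blast
    then have "coeff p j \<noteq> 0" by auto
    then have "j \<le> degree p" by (rule le_degree)
    moreover from this have "degree (coeff p j) \<le> (\<Sum>j\<le>degree p. degree (coeff p j))"
      by (intro member_le_sum) auto
    moreover have "i \<le> degree (coeff p j)" using ij(2) by (rule le_degree)
    ultimately show ?thesis using ij(1) by linarith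
  qed
  define d where "d = Greatest S"
  have "S d" unfolding d_def using ex bound by (rule GreatestI_ex_nat)
  then have top: "\<exists>i j. i + j = d \<and> coeff2 p i j \<noteq> 0" by (simp only: S_def)
  have bound_d: "i + j \<le> d" if "coeff2 p i j \<noteq> 0" for i j
  proof -
    have "S (i + j)" using that by (auto simp: S_def)
    then show ?thesis unfolding d_def using bound by (rule Greatest_le_nat)
  qed
  have "has_total_degree p d"
    unfolding has_total_degree_def by (intro conjI top allI impI bound_d)
  then show ?thesis ..
qed

text \<open>A repeated factor of \<open>p\<close> would give a repeated factor of its leading form.\<close>

lemma squarefree_if_simple_at_infinity:
  assumes deg: "\<And>i j. coeff2 p i j \<noteq> 0 \<Longrightarrow> i + j \<le> n" and a: "prop_a n p" and b: "prop_b n p"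
  shows "squarefree p"
  unfolding squarefree_iff_no_square_factor
proof
  assume "\<exists>q. (\<exists>i j. 0 < i + j \<and> coeff2 q i j \<noteq> 0) \<and> q\<^sup>2 dvd p"
  then obtain g where "\<exists>i j. 0 < i + j \<and> coeff2 g i j \<noteq> 0" "g\<^sup>2 dvd p" by blast
  then obtain i0 j0 k where g: "0 < i0 + j0" "coeff2 g i0 j0 \<noteq> 0" and p: "p = g\<^sup>2 * k"
    by (elim exE conjE dvdE)
  have "p \<noteq> 0" using a by (auto simp: prop_a_def coeff2_def)
  with p have "g \<noteq> 0" "k \<noteq> 0" by auto
  then obtain d e where d: "has_total_degree g d" and e: "has_total_degree k e"
    using total_degree_exists by blast
  have gd: "\<And>i j. coeff2 g i j \<noteq> 0 \<Longrightarrow> i + j \<le> d" and ke: "\<And>i j. coeff2 k i j \<noteq> 0 \<Longrightarrow> i + j \<le> e"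
    using d e by (auto simp: has_total_degree_def)
  have ggd: "i + j \<le> d + d" if "coeff2 (g * g) i j \<noteq> 0" for i j
    using coeff2_mult_eq_0[OF gd gd] that by (meson not_le)
  have h: "h_poly (d + d + e) p = h_poly d g * h_poly d g * h_poly e k"
    using h_poly_mult[OF ggd ke] h_poly_mult[OF gd gd] by (simp add: p power2_eq_square)
  have nz: "h_poly m q \<noteq> 0" if "has_total_degree q m" for q m
  proof -
    from that obtain i j where "i + j = m" "coeff2 q i j \<noteq> 0"
      unfolding has_total_degree_def by blast
    then have "coeff (h_poly m q) i \<noteq> 0" by (auto simp: coeff_h_poly)
    then show ?thesis by auto
  qed
  have "h_poly (d + d + e) p \<noteq> 0" unfolding h using nz d e by simp
  then obtain i where "coeff (h_poly (d + d + e) p) i \<noteq> 0" by (metis leading_coeff_0_iff)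
  then have "d + d + e \<le> n"
    using deg[of i "d + d + e - i"] by (auto simp: coeff_h_poly split: if_splits)
  moreover have "n \<le> d + d + e"
  proof (rule ccontr)
    assume "\<not> n \<le> d + d + e"
    then have "coeff2 (g * g * k) n 0 = 0" by (intro coeff2_mult_eq_0[OF ggd ke]) auto
    then show False using a by (simp add: prop_a_def p power2_eq_square)
  qed
  ultimately have n: "d + d + e = n" by simp
  \<comment> \<open>A zero of the leading form of \<open>g\<close> would be at least a double zero
    of h, contrary to (b).\<close>
  have "poly (h_poly d g) z \<noteq> 0" for z
    using b unfolding prop_b_def n[symmetric] h rsquarefree_roots
    by (auto simp: pderiv_mult dest!: spec[of _ z])
  then have "degree (h_poly d g) = 0"
    using fundamental_theorem_of_algebra constant_degree by blast
  \<comment> \<open>The leading form of \<open>g\<close> could still be a constant times a power of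
    y. Counting degrees in \<xi> excludes this: by (a), h has degree d + d + e, while its factors
    contribute 0, 0 and at most e.\<close>
  moreover have "degree (h_poly e k) \<le> e" by (intro degree_le) (simp add: coeff_h_poly)
  moreover have "degree (h_poly (d + d + e) p) = d + d + e"
    using degree_h_poly[OF a] n by simp
  moreover have "degree (h_poly (d + d + e) p) =
      degree (h_poly d g) + degree (h_poly d g) + degree (h_poly e k)"
    unfolding h using nz[OF d] nz[OF e] by (simp add: degree_mult_eq)
  ultimately have "d = 0" by simp
  then show False using gd[OF g(2)] g(1) by simp
qed

section \<open>The discriminant at infinity\<close>

lemma rsquarefree_iff_resultant:
  fixes f :: "complex poly"
  assumes "f \<noteq> 0"
  shows "rsquarefree f \<longleftrightarrow> resultant f (pderiv f) \<noteq> 0"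
proof -
  let ?g = "gcd f (pderiv f)"
  have root: "poly ?g z = 0 \<longleftrightarrow> poly f z = 0 \<and> poly (pderiv f) z = 0" for z
    by (simp add: poly_eq_0_iff_dvd)
  \<comment> \<open>Over the complex numbers, a nonconstant gcd is the same as a common zero of
    \<open>f\<close> and its derivative.\<close>
  have "degree ?g \<noteq> 0 \<longleftrightarrow> (\<exists>z. poly ?g z = 0)"
  proof
    assume "degree ?g \<noteq> 0"
    then show "\<exists>z. poly ?g z = 0"
      using fundamental_theorem_of_algebra[of ?g] constant_degree[of ?g] by simp
  next
    assume "\<exists>z. poly ?g z = 0"
    then show "degree ?g \<noteq> 0" using assms
      by (metis degree_eq_zeroE gcd_eq_0_iff pCons_0_0 poly_const_conv)
  qed
  then show ?thesis unfolding resultant_0_gcd rsquarefree_roots root by blast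
qed

text \<open>The resultant is taken with the formal degrees \<open>n\<close> and
  \<open>n - 1\<close>, so that it stays one fixed polynomial in the coefficients even where the
  degree of h drops. The factor p_n0 adds condition (a).\<close>

definition disc_at_infinity :: "nat \<Rightarrow> complex poly poly \<Rightarrow> complex" where
  "disc_at_infinity n p =
    coeff2 p n 0 * resultant_sub n (n - 1) (h_poly n p) (pderiv (h_poly n p))"

text \<open>Under (a) the formal degrees are the true ones, and the formal resultant is the usual
  resultant of h and h'.\<close>

lemma disc_at_infinity_nonzero_iff: "disc_at_infinity n p \<noteq> 0 \<longleftrightarrow> prop_a n p \<and> prop_b n p"
proof (cases "prop_a n p")
  case True
  have "degree (pderiv (h_poly n p)) = n - 1"
    using degree_h_poly[OF True] by (simp add: degree_pderiv)
  then show ?thesis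
    using rsquarefree_iff_resultant[OF h_poly_nonzero[OF True]] True degree_h_poly[OF True]
    by (simp add: disc_at_infinity_def prop_b_def resultant_sub prop_a_def)
qed (simp add: disc_at_infinity_def prop_a_def)

text \<open>A Sylvester matrix of fixed size has coefficients of h and h' and zeros as entries, and
  the Leibniz formula expands its determinant.\<close>

lemma disc_at_infinity_polynomial:
  "disc_at_infinity n \<in> polynomial_functions (coefficient_functions n)"
proof -
  let ?PF = "polynomial_functions (coefficient_functions n)"
  have c: "(\<lambda>p. coeff2 p i j) \<in> ?PF" if "i + j \<le> n" for i j
    using that by (intro polynomial_functions.coord) (auto simp: coefficient_functions_def)
  have h: "(\<lambda>p. coeff (h_poly n p) i) \<in> ?PF" for i
    unfolding coeff_h_poly by (cases "i \<le> n") (auto intro: c polynomial_functions.const)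
  have h': "(\<lambda>p. coeff (pderiv (h_poly n p)) i) \<in> ?PF" for i
    unfolding coeff_pderiv by (intro polynomial_functions.mult polynomial_functions.const h)
  let ?S = "\<lambda>p. sylvester_mat_sub n (n - 1) (h_poly n p) (pderiv (h_poly n p))"
  have if_PF: "(\<lambda>p. if b then f p else g p) \<in> ?PF" if "f \<in> ?PF" "g \<in> ?PF" for b f g
    using that by (cases b) auto
  have entry: "(\<lambda>p. ?S p $$ (i, j)) \<in> ?PF" if "i < n + (n - 1)" "j < n + (n - 1)" for i j
    unfolding sylvester_mat_sub_index[OF that]
    by (intro if_PF h h' polynomial_functions.const)
  have "(\<lambda>p. Determinant.det (?S p)) \<in> ?PF"
    unfolding det_def'[OF sylvester_mat_sub_carrier]
  proof (intro polynomial_functions_sum polynomial_functions.mult polynomial_functions.const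
      polynomial_functions_prod)
    fix \<pi> i
    assume "\<pi> \<in> {\<pi>. \<pi> permutes {0..<n + (n - 1)}}" and i: "i \<in> {0..<n + (n - 1)}"
    then have "\<pi> i \<in> {0..<n + (n - 1)}"
      using permutes_in_image[of \<pi> "{0..<n + (n - 1)}" i] by simp
    with i show "(\<lambda>p. ?S p $$ (i, \<pi> i)) \<in> ?PF" by (intro entry) auto
  qed
  then have "(\<lambda>p. coeff2 p n 0 * Determinant.det (?S p)) \<in> ?PF"
    by (intro polynomial_functions.mult c) simp_all
  then show ?thesis
    unfolding disc_at_infinity_def[abs_def] resultant_sub_def .
qed

section \<open>A transversal line\<close>

lemma linear_poly_power_top:
  fixes s t :: "'a :: comm_ring_1"
  shows "coeff ([:s, t:] ^ i) i = t ^ i" and "i < m \<Longrightarrow> coeff ([:s, t:] ^ i) m = 0"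
proof -
  have "coeff ([:s, t:] ^ i) i = t ^ i \<and> (\<forall>m>i. coeff ([:s, t:] ^ i) m = 0)"
  proof (induction i)
    case (Suc i)
    then show ?case by (auto simp: coeff_pCons split: nat.splits)
  qed simp
  then show "coeff ([:s, t:] ^ i) i = t ^ i" and "i < m \<Longrightarrow> coeff ([:s, t:] ^ i) m = 0"
    by blast+
qed

text \<open>For p of degree at most \<open>n\<close> this is p(x + b y, y) as a polynomial in y over
  C[x]; the inner list \<open>[:[:0, 1:], [:b:]:]\<close> is x + b y.\<close>

definition shear_poly :: "nat \<Rightarrow> complex \<Rightarrow> complex poly poly \<Rightarrow> complex poly poly" where
  "shear_poly n b p =
    (\<Sum>i\<le>n. \<Sum>j\<le>n - i. smult [:coeff2 p i j:] (monom 1 j * [:[:0, 1:], [:b:]:] ^ i))"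

lemma val2_shear_poly: "val2 (shear_poly n b p) x y = form_val n p (x + b * y) y 1"
  by (simp add: shear_poly_def val2_def form_val_def poly_sum poly_monom poly_const_pow
      mult_ac add_ac)

text \<open>Only terms with i + j = n reach \<open>y ^ n\<close>, and they do so through the y-part
  of (x + b y)^i. The coefficient is therefore the constant h(b).\<close>

lemma coeff_shear_poly:
  "coeff (shear_poly n b p) n = [:form_val n p b 1 0:]" "n < m \<Longrightarrow> coeff (shear_poly n b p) m = 0"
proof -
  let ?L = "[:[:0, 1:], [:b:]:] :: complex poly poly"
  have "(\<Sum>j\<le>n - i. [:coeff2 p i j:] * coeff (monom 1 j * ?L ^ i) n) =
      [:coeff2 p i (n - i) * b ^ i:]" if "i \<le> n" for i
  proof -
    have "(\<Sum>j\<le>n - i. [:coeff2 p i j:] * coeff (monom 1 j * ?L ^ i) n) =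
        (\<Sum>j\<in>{n - i}. [:coeff2 p i j:] * [:b:] ^ i)"
      using that by (intro sum.mono_neutral_cong_right)
        (auto simp: coeff_monom_mult linear_poly_power_top)
    then show ?thesis by (simp add: poly_const_pow)
  qed
  then have "coeff (shear_poly n b p) n = (\<Sum>i\<le>n. [:coeff2 p i (n - i) * b ^ i:])"
    unfolding shear_poly_def coeff_sum coeff_smult by (intro sum.cong) auto
  also have "\<dots> = [:\<Sum>i\<le>n. coeff2 p i (n - i) * b ^ i:]"
    by (rule poly_ext) (simp add: poly_sum)
  also have "(\<Sum>i\<le>n. coeff2 p i (n - i) * b ^ i) = form_val n p b 1 0"
    by (simp add: poly_h_poly[symmetric] h_poly_eq poly_sum poly_monom)
  finally show "coeff (shear_poly n b p) n = [:form_val n p b 1 0:]" .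
  show "coeff (shear_poly n b p) m = 0" if "n < m"
    using that unfolding shear_poly_def coeff_sum coeff_smult
    by (intro sum.neutral ballI) (auto simp: coeff_monom_mult linear_poly_power_top)
qed

text \<open>A degree bound is chosen for each polynomial, which makes the shear available for
  divisors and cofactors of unknown degree.\<close>

lemma shear_exists: "\<exists>q. \<forall>x y. val2 q x y = val2 p (x + b * y) y"
proof -
  obtain n where n: "\<And>i j. coeff2 p i j \<noteq> 0 \<Longrightarrow> i + j \<le> n"
  proof (cases "p = 0")
    case False
    then show ?thesis using that total_degree_exists[of p] by (auto simp: has_total_degree_def)
  qed (use that in \<open>auto simp: coeff2_def\<close>)
  have "\<forall>x y. val2 (shear_poly n b p) x y = val2 p (x + b * y) y"
    by (simp add: val2_shear_poly val2_eq_form_val[OF n])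
  then show ?thesis ..
qed

text \<open>The shear is a ring automorphism with inverse given by \<open>- b\<close>. Square
  divisors of \<open>q\<close> are carried back to \<open>p\<close>, and the inverse of the
  resulting unit is carried forth again.\<close>

lemma squarefree_shear:
  assumes "squarefree p" and q: "\<And>x y. val2 q x y = val2 p (x + b * y) y"
  shows "squarefree q"
  unfolding squarefree_def
proof (intro allI impI)
  fix g
  assume "g\<^sup>2 dvd q"
  then obtain w where w: "q = g\<^sup>2 * w" by (elim dvdE)
  obtain g' where g': "val2 g' x y = val2 g (x + (- b) * y) y" for x y
    using shear_exists by metis
  obtain w' where w': "val2 w' x y = val2 w (x + (- b) * y) y" for x y
    using shear_exists by metis
  have "p = g'\<^sup>2 * w'"
  proof (rule val2_ext)
    fix x y
    have "val2 p x y = val2 q (x - b * y) y" by (simp add: q)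
    then show "val2 p x y = val2 (g'\<^sup>2 * w') x y"
      by (simp add: w power2_eq_square val2_mult g' w')
  qed
  then have "g'\<^sup>2 dvd p" by simp
  with assms(1) have "g' dvd 1" by (simp add: squarefree_def)
  then obtain m where m: "1 = g' * m" by (elim dvdE)
  obtain m' where m': "val2 m' x y = val2 m (x + b * y) y" for x y
    using shear_exists by metis
  have "1 = g * m'"
  proof (rule val2_ext)
    fix x y
    have "val2 (g * m') x y = val2 (g' * m) (x + b * y) y"
      by (simp add: val2_mult m' g')
    then show "val2 1 x y = val2 (g * m') x y"
      by (simp add: m[symmetric] val2_def)
  qed
  then show "g dvd 1" by (rule dvdI)
qed

text \<open>A common prime factor q of p = q w and p' does not divide w, hence divides its own
  derivative. In characteristic 0 this forces y-degree 0.\<close>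

lemma coprime_pderiv_if_squarefree:
  fixes p :: "complex poly poly"
  assumes "squarefree p" and lead: "lead_coeff p dvd 1"
  shows "is_unit (gcd p (pderiv p))"
proof (rule ccontr)
  assume "\<not> is_unit (gcd p (pderiv p))"
  moreover have "p \<noteq> 0" using lead by auto
  ultimately obtain q where q: "prime q" "q dvd p" "q dvd pderiv p"
    using prime_divisor_exists[of "gcd p (pderiv p)"] by auto
  then obtain w where w: "p = q * w" by (elim dvdE)
  have not_dvd: "\<not> q dvd w"
  proof
    assume "q dvd w"
    then have "q\<^sup>2 dvd p" unfolding w power2_eq_square by simp
    with assms(1) have "q dvd 1" by (simp add: squarefree_def)
    with q(1) show False by (simp add: prime_def prime_elem_def)
  qed
  have "q dvd q * pderiv w + w * pderiv q" using q(3) by (simp add: w pderiv_mult)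
  then have "q dvd w * pderiv q" by (simp add: dvd_add_right_iff)
  with not_dvd q(1) have dvd: "q dvd pderiv q" by (simp add: prime_dvd_mult_iff)
  have "degree q = 0"
  proof (rule ccontr)
    assume "degree q \<noteq> 0"
    with not_dvd_pderiv dvd show False by blast
  qed
  then obtain c where c: "q = [:c:]" by (elim degree_eq_zeroE)
  \<comment> \<open>A factor in x alone divides every coefficient; the unit leading coefficient
    rules it out.\<close>
  then have "c dvd lead_coeff p" using q(2) by (simp add: const_poly_dvd_iff)
  with lead have "c dvd 1" by (rule dvd_trans[rotated])
  then have "q dvd 1" unfolding c by (simp add: is_unit_const_poly_iff)
  with q(1) show False by (simp add: prime_def prime_elem_def)
qed

lemma transversal_line_exists:
  assumes deg: "has_total_degree p n" and "squarefree p"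
  shows "\<exists>T. invertible T \<and> prop_a n (transformed n T p) \<and> prop_b n (transformed n T p)"
proof -
  have bound: "\<And>i j. coeff2 p i j \<noteq> 0 \<Longrightarrow> i + j \<le> n"
    using deg by (auto simp: has_total_degree_def)
  have "h_poly n p \<noteq> 0"
  proof -
    from deg obtain i j where "i + j = n" "coeff2 p i j \<noteq> 0"
      unfolding has_total_degree_def by blast
    then have "coeff (h_poly n p) i \<noteq> 0" by (auto simp: coeff_h_poly)
    then show ?thesis by auto
  qed
  \<comment> \<open>The direction (b, 1) is one in which the leading form does not vanish.\<close>
  then obtain b where b: "form_val n p b 1 0 \<noteq> 0"
    unfolding poly_h_poly[symmetric] using poly_all_0_iff_0 by blast
  define q where "q = shear_poly n b p"
  have val_q: "val2 q x y = val2 p (x + b * y) y" for x y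
    unfolding q_def val2_shear_poly by (rule val2_eq_form_val[OF bound, symmetric])
  have deg_q: "degree q = n"
    using b by (intro antisym degree_le le_degree) (auto simp: q_def coeff_shear_poly)
  then have lead: "lead_coeff q = [:form_val n p b 1 0:]"
    by (simp add: q_def coeff_shear_poly)
  then have "lead_coeff q dvd 1" using b by (simp add: is_unit_const_poly_iff dvd_field_iff)
  moreover have "squarefree q" using assms(2) val_q by (rule squarefree_shear)
  ultimately have "is_unit (gcd q (pderiv q))" by (intro coprime_pderiv_if_squarefree)
  then have "degree (gcd q (pderiv q)) = 0" using is_unit_iff_degree
    by (metis degree_1 dvd_imp_degree_le le_zero_eq one_neq_zero)
  then have "resultant q (pderiv q) \<noteq> 0" by (simp add: resultant_0_gcd)
  \<comment> \<open>The resultant is a nonzero polynomial in x; outside its zeros, the line x = a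
    meets the sheared curve in simple points only.\<close>
  then obtain a where a: "poly (resultant q (pderiv q)) a \<noteq> 0"
    using poly_all_0_iff_0 by blast
  have hom: "comm_ring_hom (\<lambda>r :: complex poly. poly r a)"
    by unfold_locales auto
  define u where "u = map_poly (\<lambda>r. poly r a) q"
  have coeff_u: "coeff u n = form_val n p b 1 0"
    using lead deg_q by (simp add: u_def coeff_map_poly)
  then have deg_u: "degree u = n"
    using b deg_q degree_map_poly_le[of "\<lambda>r. poly r a" q]
    by (intro antisym le_degree) (auto simp: u_def)
  have pderiv_u: "map_poly (\<lambda>r. poly r a) (pderiv q) = pderiv u"
    by (rule poly_eqI) (simp add: u_def coeff_map_poly coeff_pderiv)
  \<comment> \<open>Specializing x to \<open>a\<close> commutes with the resultant because neither
    degree drops: the leading coefficient of \<open>q\<close> is constant.\<close>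
  have "resultant u (pderiv u) = poly (resultant q (pderiv q)) a"
    unfolding pderiv_u[symmetric] unfolding u_def
    by (rule comm_ring_hom.resultant_map_poly[OF hom])
      (simp_all add: pderiv_u degree_pderiv deg_q deg_u flip: u_def)
  with a have "resultant u (pderiv u) \<noteq> 0" by simp
  moreover have "u \<noteq> 0" using coeff_u b by auto
  ultimately have u: "rsquarefree u" by (simp add: rsquarefree_iff_resultant)
  have poly_u: "poly u y = val2 q a y" for y
    unfolding u_def val2_def by (induction q) (simp_all add: map_poly_pCons)
  \<comment> \<open>\<open>T\<close> maps the line at infinity to the line \<open>x = a\<close> of the sheared coordinates.\<close>
  let ?T = "vector [vector [b, a, 1], vector [1, 0, 0], vector [0, 1, 0]] :: complex ^ 3 ^ 3"
  have form: "form_val n (transformed n ?T p) x y z = form_val n p (b * x + a * y + z) x y" for x y z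
    by (simp add: form_val_transformed)
  have "h_poly n (transformed n ?T p) = u"
    by (rule poly_ext)
      (simp add: poly_h_poly form poly_u val_q val2_eq_form_val[OF bound] add.commute)
  then have "prop_b n (transformed n ?T p)" using u by (simp add: prop_b_def)
  \<comment> \<open>\<open>?T\<close> sends (1, 0, 0) to (b, 1, 0), so the new p_n0 is h(b).\<close>
  moreover have "prop_a n (transformed n ?T p)"
    using form[of 1 0 0] b by (simp add: prop_a_def form_val_x)
  moreover have "invertible ?T"
    by (simp add: invertible_det_nz det_3)
  ultimately show ?thesis by blast
qed

section \<open>Conclusion\<close>

lemma generic_transformed:
  assumes "1 \<le> n" "has_total_degree p n" "squarefree p"
  shows "generic entry_functions {T. invertible T}
    (\<lambda>T. prop_a n (transformed n T p) \<and> prop_b n (transformed n T p))"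
proof -
  obtain W where W: "invertible W" "disc_at_infinity n (transformed n W p) \<noteq> 0"
    using transversal_line_exists[OF assms(2,3)] by (auto simp: disc_at_infinity_nonzero_iff)
  \<comment> \<open>The factor \<open>det T\<close> ensures that points of the connecting line with
    \<open>\<Phi>\<close> nonzero are invertible matrices.\<close>
  define \<Phi> where "\<Phi> T = disc_at_infinity n (transformed n T p) * det T" for T
  define L :: "complex ^ 3 ^ 3 \<Rightarrow> complex \<Rightarrow> complex ^ 3 ^ 3"
    where "L T u = (\<chi> i j. (1 - u) * T $ i $ j + u * W $ i $ j)" for T u
  have "(\<lambda>T. disc_at_infinity n (transformed n T p)) \<in> polynomial_functions entry_functions"
    by (rule polynomial_functions_compose[OF disc_at_infinity_polynomial])
      (auto simp: coefficient_functions_def coeff2_transformed_polynomial)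
  then have \<Phi>: "\<Phi> \<in> polynomial_functions entry_functions"
    unfolding \<Phi>_def[abs_def] by (intro polynomial_functions.mult det_polynomial)
  have id: "(\<lambda>u. u) \<in> polynomial_functions {\<lambda>u :: complex. u}"
    by (rule polynomial_functions.coord) simp
  show ?thesis
  proof (rule generic_via_lines[of \<Phi> _ W _ _ L])
    show "\<Phi> W \<noteq> 0" using W by (simp add: \<Phi>_def invertible_det_nz)
    show "prop_a n (transformed n T p) \<and> prop_b n (transformed n T p)" if "\<Phi> T \<noteq> 0" for T
      using that by (simp add: \<Phi>_def disc_at_infinity_nonzero_iff)
    show "L T u \<in> {T. invertible T}" if "\<Phi> (L T u) \<noteq> 0" for T u
      using that by (simp add: \<Phi>_def invertible_det_nz)
    show "L T 0 = T" for T by (simp add: L_def vec_eq_iff)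
    show "g (L T 1) = g W" if "g \<in> entry_functions" for T g
      using that by (auto simp: entry_functions_def L_def)
    show "(\<lambda>u. g (L T u)) \<in> polynomial_functions {\<lambda>u. u}" if mem: "g \<in> entry_functions" for T g
    proof -
      obtain i j where g: "g = (\<lambda>T. T $ i $ j)" using mem by (auto simp: entry_functions_def)
      have "(\<lambda>u. g (L T u)) = (\<lambda>u. (T $ i $ j + (- T $ i $ j) * u) + u * W $ i $ j)"
        by (simp add: g L_def algebra_simps)
      then show ?thesis
        by (simp only:) (intro polynomial_functions.add polynomial_functions.mult
            polynomial_functions.const id)
    qed
  qed (use \<Phi> in auto)
qed

text \<open>The lines end in a transform of \<open>p\<close> that has (a) and (b). Squarefreeness
  need not persist along such a line, but it returns wherever the discriminant at infinity is
  nonzero.\<close>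

lemma generic_squarefree:
  assumes "1 \<le> n" "has_total_degree p n" "squarefree p"
  shows "generic (coefficient_functions n) {q. has_total_degree q n \<and> squarefree q}
    (\<lambda>q. prop_a n q \<and> prop_b n q)"
proof -
  obtain T where T: "disc_at_infinity n (transformed n T p) \<noteq> 0"
    using transversal_line_exists[OF assms(2,3)] by (auto simp: disc_at_infinity_nonzero_iff)
  define w where "w = transformed n T p"
  have w: "coeff2 w i j \<noteq> 0 \<Longrightarrow> i + j \<le> n" for i j
    by (auto simp: w_def coeff2_transformed split: if_splits)
  define L where "L q u = smult [:1 - u:] q + smult [:u:] w" for q :: "complex poly poly" and u
  have coeff_L: "coeff2 (L q u) i j = (1 - u) * coeff2 q i j + u * coeff2 w i j" for q u i j
    by (simp add: L_def coeff2_def)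
  have id: "(\<lambda>u. u) \<in> polynomial_functions {\<lambda>u :: complex. u}"
    by (rule polynomial_functions.coord) simp
  show ?thesis
  proof (rule generic_via_lines[of "disc_at_infinity n" _ w _ _ L])
    show "disc_at_infinity n w \<noteq> 0" using T by (simp add: w_def)
    show "prop_a n q \<and> prop_b n q" if "disc_at_infinity n q \<noteq> 0" for q
      using that by (simp add: disc_at_infinity_nonzero_iff)
    show "L q u \<in> {q. has_total_degree q n \<and> squarefree q}"
      if q: "q \<in> {q. has_total_degree q n \<and> squarefree q}"
        and "disc_at_infinity n (L q u) \<noteq> 0" for q u
    proof -
      have ab: "prop_a n (L q u)" "prop_b n (L q u)"
        using that by (simp_all add: disc_at_infinity_nonzero_iff)
      have bound: "i + j \<le> n" if "coeff2 (L q u) i j \<noteq> 0" for i j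
      proof -
        have "coeff2 q i j \<noteq> 0 \<or> coeff2 w i j \<noteq> 0" using that by (auto simp: coeff_L)
        then show ?thesis using q w[of i j] unfolding has_total_degree_def by blast
      qed
      \<comment> \<open>The bound is inherited from both ends of the line, and (a) provides a
        monomial of degree exactly \<open>n\<close>.\<close>
      have "has_total_degree (L q u) n"
        unfolding has_total_degree_def
      proof (intro conjI allI impI bound)
        show "\<exists>i j. i + j = n \<and> coeff2 (L q u) i j \<noteq> 0"
          using ab(1) by (intro exI[of _ n] exI[of _ 0]) (simp add: prop_a_def)
      qed
      then show ?thesis
        using squarefree_if_simple_at_infinity[OF bound ab] by simp
    qed
    show "L q 0 = q" for q by (simp add: L_def)
    show "g (L q 1) = g w" if "g \<in> coefficient_functions n" for q g
      using that by (auto simp: coefficient_functions_def coeff_L)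
    show "(\<lambda>u. g (L q u)) \<in> polynomial_functions {\<lambda>u. u}"
      if mem: "g \<in> coefficient_functions n" for q g
    proof -
      obtain i j where g: "g = (\<lambda>q. coeff2 q i j)"
        using mem by (auto simp: coefficient_functions_def)
      have "(\<lambda>u. g (L q u)) = (\<lambda>u. (coeff2 q i j + (- coeff2 q i j) * u) + u * coeff2 w i j)"
        by (simp add: g coeff_L algebra_simps)
      then show ?thesis
        by (simp only:) (intro polynomial_functions.add polynomial_functions.mult
            polynomial_functions.const id)
    qed
  qed (rule disc_at_infinity_polynomial)
qed

text \<open>This shows that the concluding claim is not vacuous: after the first step h has degree n
  \<ge> 1 and thus a root.\<close>

lemma first_step_exists:
  assumes "1 \<le> n" "has_total_degree p n" "squarefree p"
  shows "\<exists>r s. first_step n p r \<and> poly (h_poly n r) s = 0"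
proof -
  obtain r where r: "first_step n p r"
  proof (cases "prop_a n p \<and> prop_b n p")
    case True
    then show ?thesis using that[of p] by (simp add: first_step_def)
  next
    case False
    obtain T where "invertible T" "prop_a n (transformed n T p)" "prop_b n (transformed n T p)"
      using transversal_line_exists[OF assms(2,3)] by (elim exE conjE)
    with False have "first_step n p (transformed n T p)" unfolding first_step_def by auto
    then show ?thesis by (rule that)
  qed
  then have "degree (h_poly n r) = n" by (simp add: first_step_def degree_h_poly)
  then obtain s where "poly (h_poly n r) s = 0"
    using fundamental_theorem_of_algebra[of "h_poly n r"] constant_degree[of "h_poly n r"] assms(1)
    by auto
  with r show ?thesis by blast
qed

text \<open>The shear makes 0 a root of h and keeps all roots simple, so that v inherits simple,
  nonzero zeros.\<close>

lemma second_step: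
  assumes "1 \<le> n" "prop_a n r" "prop_b n r" "poly (h_poly n r) s = 0"
  shows "let q = transformed n (shear s (t_value n r s)) r in
    coeff2 q n 0 \<noteq> 0 \<and> rsquarefree (v_poly n q) \<and> poly (v_poly n q) 0 \<noteq> 0 \<and>
    coeff2 q 0 n = 0 \<and> coeff2 q 0 (n - 1) = 0"
  using shear_step[OF assms] v_poly_simple_nonzero[OF assms(1)]
  by (auto simp: Let_def prop_a_def)

theorem mainTheorem2:
  fixes n :: nat and p :: "complex poly poly"
  assumes deg: "has_total_degree p n"
    and nonconst: "1 \<le> n"
    and sqfree: "squarefree p"
  shows
    "(prop_a n p \<longrightarrow> (prop_b n p \<longleftrightarrow> card (points_at_infinity n p) = n))
    \<and> generic (coefficient_functions n) {q. has_total_degree q n \<and> squarefree q}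
        (\<lambda>q. prop_a n q \<and> prop_b n q)
    \<and> (\<not> (prop_a n p \<and> prop_b n p) \<longrightarrow>
        generic entry_functions {T. invertible T}
          (\<lambda>T. prop_a n (transformed n T p) \<and> prop_b n (transformed n T p)))
    \<and> (prop_a n p \<and> prop_b n p \<longrightarrow>
        (\<forall>s. poly (h_poly n p) s = 0 \<longrightarrow>
          poly (pderiv (h_poly n p)) s \<noteq> 0 \<and>
          (let q = transformed n (shear s (t_value n p s)) p in
            coeff2 q 0 n = 0 \<and> coeff2 q 0 (n - 1) = 0 \<and>
            coeff2 q n 0 = coeff2 p n 0 \<and> prop_a n q \<and> prop_b n q \<and>
            (\<forall>\<xi>. eval3 (\<lambda>c. c) (homogenization n q) \<xi> 1 0 =
                 eval3 (\<lambda>c. c) (homogenization n p) (\<xi> + s) 1 0) \<and>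
            {\<xi>. poly (h_poly n q) \<xi> = 0} = (\<lambda>\<xi>. \<xi> - s) ` {\<xi>. poly (h_poly n p) \<xi> = 0})))
    \<and> (\<exists>r s. first_step n p r \<and> poly (h_poly n r) s = 0)
    \<and> (\<forall>r s. first_step n p r \<and> poly (h_poly n r) s = 0 \<longrightarrow>
        (let q = transformed n (shear s (t_value n r s)) r in
          coeff2 q n 0 \<noteq> 0 \<and>
          rsquarefree (v_poly n q) \<and> poly (v_poly n q) 0 \<noteq> 0 \<and>
          coeff2 q 0 n = 0 \<and> coeff2 q 0 (n - 1) = 0))"
proof (intro conjI[OF _ conjI[OF _ conjI[OF _ conjI[OF _ conjI]]]])
  show "prop_a n p \<longrightarrow> (prop_b n p \<longleftrightarrow> card (points_at_infinity n p) = n)"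
    using prop_b_iff_card_points_at_infinity by blast
  show "\<exists>r s. first_step n p r \<and> poly (h_poly n r) s = 0"
    by (rule first_step_exists[OF nonconst deg sqfree])
next
  show "\<forall>r s. first_step n p r \<and> poly (h_poly n r) s = 0 \<longrightarrow>
        (let q = transformed n (shear s (t_value n r s)) r in
          coeff2 q n 0 \<noteq> 0 \<and>
          rsquarefree (v_poly n q) \<and> poly (v_poly n q) 0 \<noteq> 0 \<and>
          coeff2 q 0 n = 0 \<and> coeff2 q 0 (n - 1) = 0)"
    by (intro allI impI second_step[OF nonconst]) (simp_all add: first_step_def)
next
  show "prop_a n p \<and> prop_b n p \<longrightarrow>
        (\<forall>s. poly (h_poly n p) s = 0 \<longrightarrow>
          poly (pderiv (h_poly n p)) s \<noteq> 0 \<and>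
          (let q = transformed n (shear s (t_value n p s)) p in
            coeff2 q 0 n = 0 \<and> coeff2 q 0 (n - 1) = 0 \<and>
            coeff2 q n 0 = coeff2 p n 0 \<and> prop_a n q \<and> prop_b n q \<and>
            (\<forall>\<xi>. eval3 (\<lambda>c. c) (homogenization n q) \<xi> 1 0 =
                 eval3 (\<lambda>c. c) (homogenization n p) (\<xi> + s) 1 0) \<and>
            {\<xi>. poly (h_poly n q) \<xi> = 0} = (\<lambda>\<xi>. \<xi> - s) ` {\<xi>. poly (h_poly n p) \<xi> = 0}))"
    by (intro allI impI shear_step[OF nonconst]) simp_all
qed (use generic_squarefree[OF nonconst deg sqfree] generic_transformed[OF nonconst deg sqfree]
    in simp_all)

end
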